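(* Let $k \geq 2$ be an integer, $c \geq 0$ real, $\star \in \{\leq,<\}$, and let $\mathcal{A} = \{a_i\}_{i\in\mathbb{N}} \subseteq \mathbb{N}_0$ with $a_1 < a_2 < a_3 < \cdots$. If either $c>0$ or the set $\{a_s/s^k\}_{s\in\mathbb{N}}$ is bounded, then \[ \limsup_{n\to\infty} E^\star_{k,c}(\mathcal{A},n) > 0, \qquad\text{where } E^\star_{k,c}(\mathcal{A},n) = \frac{1}{n}\sum_{j=0}^{n}\big(r^\star_k(\mathcal{A},j)-c\big)^2 . \]
   Context: $\mathbb{N}=\{1,2,\dots\}$, $\mathbb{N}_0=\mathbb{N}\cup\{0\}$. For $\mathcal{A}\subseteq\mathbb{N}_0$ and $n\ge 0$, $r^{\leq}_k(\mathcal{A},n) = \#\{(a_1,\dots,a_k)\in\mathcal{A}^k : a_1\le\dots\le a_k,\ a_1+\dots+a_k=n\}$ and $r^{<}_k(\mathcal{A},n) = \#\{(a_1,\dots,a_k)\in\mathcal{A}^k : a_1<\dots<a_k,\ a_1+\dots+a_k=n\}$. *)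

theory Defs
  imports "HOL-Analysis.Analysis"
begin

text \<open>The order \<open>R\<close> plays the role of \<open>\<star>\<close>: it is meant to be \<open>(\<le>)\<close> or \<open>(<)\<close>,
  and a \<open>k\<close>-tuple is a list of length \<open>k\<close>.\<close>

definition rep_count :: "(nat \<Rightarrow> nat \<Rightarrow> bool) \<Rightarrow> nat \<Rightarrow> nat set \<Rightarrow> nat \<Rightarrow> nat" where
  "rep_count R k A n =
     card {xs. length xs = k \<and> set xs \<subseteq> A \<and> sorted_wrt R xs \<and> sum_list xs = n}"

definition mean_sq_error ::
    "(nat \<Rightarrow> nat \<Rightarrow> bool) \<Rightarrow> nat \<Rightarrow> real \<Rightarrow> nat set \<Rightarrow> nat \<Rightarrow> real" where
  "mean_sq_error R k c A n = 1 / real n * (\<Sum>j = 0..n. (real (rep_count R k A j) - c)\<^sup>2)"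

end

theory Submission
  imports Defs "HOL-Combinatorics.Multiset_Permutations"
begin

text \<open>
  If the upper limit vanishes and \<open>c > 0\<close>, then the number \<open>R j\<close> of ordered \<open>k\<close>-tuples with sum \<open>j\<close>
  is close to the constant \<open>C = k! c\<close> in quadratic mean: tuples with a repeated entry are negligible,
  because their generating function is dominated by \<open>f(z\<^sup>2) f(z)\<^bsup>k-2\<^esup>\<close>, which is
  small in mean square compared with \<open>f(z)\<^bsup>k\<^esup>\<close>.  On the circle of radius \<open>\<rho> = 1 - 1/h\<close>, the function
  \<open>f(z)\<^bsup>k\<^esup> (1 - z\<^bsup>L\<^esup>)\<close> is then \<open>C (1 + z + \<dots> + z\<^bsup>L-1\<^esup>)\<close> plus an error, so its mean modulus is at most
  of order \<open>\<surd>L + o(\<surd>h)\<close>.  On the other hand, \<open>f\<close> has about \<open>h\<^bsup>1/k\<^esup>\<close> relevant terms, so some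
  shift \<open>L = o(h)\<close> makes \<open>f\<close> and \<open>z\<^bsup>L\<^esup> f\<close> nearly orthogonal, and the power mean inequality bounds the
  mean modulus from below by a constant times \<open>\<surd>h\<close>.  Means over the circle are taken over the \<open>Q\<close>-th roots of
  unity, with \<open>Q\<close> exceeding all degrees, so that everything is a finite sum.  The case
  \<open>c = 0\<close> is a count of the \<open>k\<close>-subsets of \<open>{a 1, \<dots>, a s}\<close>.
\<close>

section \<open>Means over roots of unity\<close>

definition unity_roots :: "nat \<Rightarrow> complex set" where
  "unity_roots Q = {z. z ^ Q = 1}"

definition circle_mean :: "nat \<Rightarrow> (complex \<Rightarrow> real) \<Rightarrow> real" where
  "circle_mean Q F = (\<Sum>z\<in>unity_roots Q. F z) / real Q"

lemma card_unity_roots: "Q > 0 \<Longrightarrow> card (unity_roots Q) = Q"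
  unfolding unity_roots_def using card_roots_unity_eq[of Q] by simp

lemma norm_unity_root: "Q > 0 \<Longrightarrow> z \<in> unity_roots Q \<Longrightarrow> norm z = 1"
  unfolding unity_roots_def using power_eq_1_iff by blast

text \<open>Multiplication by the primitive root \<open>w\<close> permutes the roots of unity and
  multiplies the sum by \<open>w ^ m \<noteq> 1\<close>.\<close>

lemma sum_unity_roots_power:
  assumes "0 < m" "m < Q"
  shows "(\<Sum>z\<in>unity_roots Q. z ^ m) = 0"
proof -
  define w where "w = cis (2 * pi / real Q)"
  have Q: "Q > 0" using assms by simp
  have wQ: "w ^ Q = 1" 
  proof -
    have "real Q * (2 * pi / real Q) = 2 * pi" using Q by simp
    then show ?thesis unfolding w_def Complex.DeMoivre by (simp only: cis_2pi)
  qed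
  have w0: "w \<noteq> 0" by (simp add: w_def)
  have "w ^ m \<noteq> 1"
  proof
    assume "w ^ m = 1"
    then have "cis (2 * pi * real m / real Q) = cis (2 * pi * real 0 / real Q)"
      by (simp add: w_def Complex.DeMoivre mult.commute)
    moreover have "inj_on (\<lambda>k. cis (2 * pi * real k / real Q)) {..<Q}"
      using Complex.bij_betw_roots_unity[OF Q] by (simp add: bij_betw_def)
    ultimately have "m = 0" using assms by (metis (no_types, lifting) inj_onD lessThan_iff Q)
    with assms show False by simp
  qed
  moreover have "(\<Sum>z\<in>unity_roots Q. z ^ m) = (\<Sum>z\<in>unity_roots Q. (w * z) ^ m)"
    by (rule sum.reindex_bij_witness[of _ "\<lambda>z. w * z" "\<lambda>z. z / w"])
       (use wQ w0 in \<open>auto simp: unity_roots_def power_mult_distrib power_divide\<close>)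
  moreover have "\<dots> = w ^ m * (\<Sum>z\<in>unity_roots Q. z ^ m)"
    by (simp add: power_mult_distrib sum_distrib_left)
  ultimately show ?thesis by simp
qed

text \<open>Conjugation is inversion on the unit circle, so each summand is a power of
  \<open>z\<close> or the conjugate of one, with exponent \<bar>\<open>i - j\<close>\<bar> below
  \<open>Q\<close>.\<close>

lemma sum_unity_roots_orthogonal:
  assumes "i < Q" "j < Q"
  shows "(\<Sum>z\<in>unity_roots Q. z ^ i * cnj (z ^ j)) = (if i = j then of_nat Q else 0)"
proof -
  have Q: "Q > 0" using assms by simp
  have c: "z ^ n * cnj (z ^ n) = 1" if "z \<in> unity_roots Q" for z n
    using norm_unity_root[OF Q that] complex_norm_square[of "z ^ n"] by (simp add: norm_power)
  consider "i = j" | "j < i" | "i < j" by linarith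
  then show ?thesis
  proof cases
    case 1
    then have "(\<Sum>z\<in>unity_roots Q. z ^ i * cnj (z ^ j)) = (\<Sum>z\<in>unity_roots Q. 1)"
      using c by (intro sum.cong) auto
    then show ?thesis using 1 card_unity_roots[OF Q] by simp
  next
    case 2
    have "z ^ i * cnj (z ^ j) = z ^ (i - j)" if "z \<in> unity_roots Q" for z
    proof -
      have "z ^ i = z ^ (i - j) * z ^ j" using 2 by (simp flip: power_add)
      then show ?thesis using c[OF that, of j] by (simp add: mult.assoc)
    qed
    then have "(\<Sum>z\<in>unity_roots Q. z ^ i * cnj (z ^ j)) = (\<Sum>z\<in>unity_roots Q. z ^ (i - j))"
      by (intro sum.cong) auto
    then show ?thesis using 2 assms sum_unity_roots_power[of "i - j" Q] by simp
  next
    case 3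
    have "z ^ i * cnj (z ^ j) = cnj (z ^ (j - i))" if "z \<in> unity_roots Q" for z
    proof -
      have "z ^ j = z ^ (j - i) * z ^ i" using 3 by (simp flip: power_add)
      then show ?thesis using c[OF that, of i] by (simp add: mult_ac)
    qed
    then have "(\<Sum>z\<in>unity_roots Q. z ^ i * cnj (z ^ j)) = cnj (\<Sum>z\<in>unity_roots Q. z ^ (j - i))"
      by (simp only: cnj_sum) (intro sum.cong, auto)
    then show ?thesis using 3 assms sum_unity_roots_power[of "j - i" Q] by simp
  qed
qed

text \<open>Discrete Parseval: \<open>n < Q\<close> rules out aliasing, so only the diagonal of the
  expanded square survives.\<close>

lemma circle_mean_parseval:
  fixes c :: "nat \<Rightarrow> real"
  assumes "n < Q"
  shows "circle_mean Q (\<lambda>z. (cmod (\<Sum>j\<le>n. of_real (c j) * z ^ j))\<^sup>2) = (\<Sum>j\<le>n. (c j)\<^sup>2)"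
proof -
  have "complex_of_real (\<Sum>z\<in>unity_roots Q. (cmod (\<Sum>j\<le>n. of_real (c j) * z ^ j))\<^sup>2)
      = (\<Sum>z\<in>unity_roots Q. (\<Sum>i\<le>n. of_real (c i) * z ^ i) * cnj (\<Sum>j\<le>n. of_real (c j) * z ^ j))"
    unfolding of_real_sum by (intro sum.cong refl complex_norm_square)
  also have "\<dots> = (\<Sum>z\<in>unity_roots Q. \<Sum>i\<le>n. \<Sum>j\<le>n. of_real (c i * c j) * (z ^ i * cnj (z ^ j)))"
    by (simp add: sum_product mult_ac)
  also have "\<dots> = (\<Sum>i\<le>n. \<Sum>z\<in>unity_roots Q. \<Sum>j\<le>n. of_real (c i * c j) * (z ^ i * cnj (z ^ j)))"
    by (rule sum.swap)
  also have "\<dots> = (\<Sum>i\<le>n. \<Sum>j\<le>n. \<Sum>z\<in>unity_roots Q. of_real (c i * c j) * (z ^ i * cnj (z ^ j)))"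
    by (intro sum.cong refl sum.swap)
  also have "\<dots> = (\<Sum>i\<le>n. \<Sum>j\<le>n. of_real (c i * c j) * (if i = j then of_nat Q else 0))"
    using assms by (intro sum.cong refl) (simp only: sum_distrib_left[symmetric], subst sum_unity_roots_orthogonal, auto)
  also have "\<dots> = (\<Sum>i\<le>n. of_real (c i * c i) * of_nat Q)"
    by (intro sum.cong refl) (simp add: if_distrib cong: if_cong)
  also have "\<dots> = complex_of_real (real Q * (\<Sum>i\<le>n. (c i)\<^sup>2))"
    by (simp add: sum_distrib_left power2_eq_square mult_ac)
  finally have "(\<Sum>z\<in>unity_roots Q. (cmod (\<Sum>j\<le>n. of_real (c j) * z ^ j))\<^sup>2)
      = real Q * (\<Sum>i\<le>n. (c i)\<^sup>2)"
    by (simp only: of_real_eq_iff)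
  then show ?thesis using assms by (simp add: circle_mean_def)
qed

lemma circle_mean_mono:
  "(\<And>z. z \<in> unity_roots Q \<Longrightarrow> F z \<le> G z) \<Longrightarrow> circle_mean Q F \<le> circle_mean Q G"
  unfolding circle_mean_def by (intro divide_right_mono sum_mono) auto

lemma circle_mean_add: "circle_mean Q (\<lambda>z. F z + G z) = circle_mean Q F + circle_mean Q G"
  unfolding circle_mean_def by (simp add: sum.distrib add_divide_distrib)

lemma circle_mean_cmult: "circle_mean Q (\<lambda>z. b * F z) = b * circle_mean Q F"
  unfolding circle_mean_def by (simp flip: sum_distrib_left)

lemma circle_mean_const: "Q > 0 \<Longrightarrow> circle_mean Q (\<lambda>z. b) = b"
  unfolding circle_mean_def by (simp add: card_unity_roots)

text \<open>Cauchy-Schwarz against the constant 1; for \<open>Q = 0\<close> both sides are 0 by the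
  convention on division.\<close>

lemma circle_mean_le_sqrt:
  "circle_mean Q F \<le> sqrt (circle_mean Q (\<lambda>z. (F z)\<^sup>2))"
proof (cases "Q = 0")
  case True
  then show ?thesis by (simp add: circle_mean_def)
next
  case False
  have "(\<Sum>z\<in>unity_roots Q. F z * 1)\<^sup>2 \<le> (\<Sum>z\<in>unity_roots Q. (F z)\<^sup>2) * (\<Sum>z\<in>unity_roots Q. 1\<^sup>2)"
    by (rule Cauchy_Schwarz_ineq_sum)
  then have "(\<Sum>z\<in>unity_roots Q. F z)\<^sup>2 \<le> (\<Sum>z\<in>unity_roots Q. (F z)\<^sup>2) * real Q"
    using False by (simp add: card_unity_roots)
  then have "(circle_mean Q F)\<^sup>2 \<le> circle_mean Q (\<lambda>z. (F z)\<^sup>2)"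
    using False by (simp add: circle_mean_def power_divide field_simps power2_eq_square)
  then show ?thesis by (rule real_le_rsqrt)
qed

text \<open>Since 2 is invertible modulo an odd \<open>Q\<close>, squaring permutes the roots of
  unity. This later removes the doubled argument in \<open>f(z\<^sup>2)\<close>.\<close>

lemma circle_mean_square_arg:
  assumes "odd Q"
  shows "circle_mean Q (\<lambda>z. F (z\<^sup>2)) = circle_mean Q F"
proof -
  obtain m where m: "Q = 2 * m + 1" using assms by (auto elim: oddE)
  have inv: "z ^ (2 * (m + 1)) = z" if "z ^ Q = 1" for z :: complex
  proof -
    have "2 * (m + 1) = Q + 1" using m by simp
    then show ?thesis using that by (simp only: power_add) simp
  qed
  have "(\<Sum>z\<in>unity_roots Q. F (z\<^sup>2)) = (\<Sum>z\<in>unity_roots Q. F z)"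
  proof (rule sum.reindex_bij_witness[of _ "\<lambda>z. z ^ (m + 1)" "\<lambda>z. z\<^sup>2"])
    fix z assume "z \<in> unity_roots Q"
    then have z: "z ^ Q = 1" by (simp add: unity_roots_def)
    show "(z\<^sup>2) ^ (m + 1) = z" "(z ^ (m + 1))\<^sup>2 = z"
      using inv[OF z] by (simp_all only: power_mult[symmetric] mult.commute)
    show "z\<^sup>2 \<in> unity_roots Q" "z ^ (m + 1) \<in> unity_roots Q"
      using power_mult[of z 2 Q] power_mult[of z Q 2] power_mult[of z "m + 1" Q] power_mult[of z Q "m + 1"] z
      by (simp_all only: unity_roots_def mem_Collect_eq mult.commute power_one)
  qed auto
  then show ?thesis by (simp add: circle_mean_def)
qed

section \<open>Tuples with prescribed sum\<close>

definition tuples :: "nat \<Rightarrow> nat set \<Rightarrow> nat \<Rightarrow> nat list set" where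
  "tuples k A n = {xs. length xs = k \<and> set xs \<subseteq> A \<and> sum_list xs = n}"

text \<open>The first component counts twice in the sum: these encode tuples with a repeated entry.\<close>

definition twin_tuples :: "nat \<Rightarrow> nat set \<Rightarrow> nat \<Rightarrow> (nat \<times> nat list) set" where
  "twin_tuples k A n =
     {(y, zs). y \<in> A \<and> length zs = k - 2 \<and> set zs \<subseteq> A \<and> 2 * y + sum_list zs = n}"

text \<open>Each entry is at most the sum. The truncated set is finite, so its generating function
  is a polynomial.\<close>

lemma tuples_truncate: "n \<le> H \<Longrightarrow> tuples k (A \<inter> {..H}) n = tuples k A n"
  unfolding tuples_def using member_le_sum_list by fastforce

lemma twin_tuples_truncate: "n \<le> H \<Longrightarrow> twin_tuples k (A \<inter> {..H}) n = twin_tuples k A n"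
  unfolding twin_tuples_def using member_le_sum_list by fastforce

lemma tuples_mono: "A \<subseteq> B \<Longrightarrow> tuples k A n \<subseteq> tuples k B n"
  unfolding tuples_def by auto

lemma finite_tuples: "finite (tuples k A n)"
proof (rule finite_subset)
  show "tuples k A n \<subseteq> {xs. set xs \<subseteq> {..n} \<and> length xs = k}"
    unfolding tuples_def using member_le_sum_list by auto
qed (simp add: finite_lists_length_eq)

lemma finite_twin_tuples: "finite (twin_tuples k A n)"
proof (rule finite_subset)
  show "twin_tuples k A n \<subseteq> {..n} \<times> {xs. set xs \<subseteq> {..n} \<and> length xs = k - 2}"
    unfolding twin_tuples_def using member_le_sum_list by fastforce
qed (simp add: finite_lists_length_eq)

section \<open>Polynomial generating functions of the tuple counts\<close>

lemma sum_power_group: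
  fixes w :: "'a::comm_semiring_1" and \<phi> :: "'b \<Rightarrow> nat"
  assumes "finite X" "\<And>x. x \<in> X \<Longrightarrow> \<phi> x \<le> n"
  shows "(\<Sum>x\<in>X. w ^ \<phi> x) = (\<Sum>j\<le>n. of_nat (card {x \<in> X. \<phi> x = j}) * w ^ j)"
proof -
  have "(\<Sum>x\<in>X. w ^ \<phi> x) = (\<Sum>j\<le>n. \<Sum>x\<in>{x \<in> X. \<phi> x = j}. w ^ \<phi> x)"
    using assms by (intro sum.group[symmetric]) auto
  also have "\<dots> = (\<Sum>j\<le>n. \<Sum>x\<in>{x \<in> X. \<phi> x = j}. w ^ j)"
    by (intro sum.cong) auto
  finally show ?thesis by simp
qed

lemma power_sum_powers_lists:
  fixes w :: "'a::comm_semiring_1"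
  assumes "finite X"
  shows "(\<Sum>a\<in>X. w ^ a) ^ k = (\<Sum>xs\<in>{xs. set xs \<subseteq> X \<and> length xs = k}. w ^ sum_list xs)"
proof (induction k)
  case 0
  have "{xs. set xs \<subseteq> X \<and> length xs = 0} = {[]}" by auto
  then show ?case by simp
next
  case (Suc k)
  let ?L = "{xs. set xs \<subseteq> X \<and> length xs = k}"
  have eq: "{xs. set xs \<subseteq> X \<and> length xs = Suc k} = (\<lambda>(x, xs). x # xs) ` (X \<times> ?L)"
    by (auto simp: image_iff length_Suc_conv)
  have inj: "inj_on (\<lambda>(x, xs). x # xs) (X \<times> ?L)" by (auto simp: inj_on_def)
  have "(\<Sum>a\<in>X. w ^ a) ^ Suc k = (\<Sum>a\<in>X. w ^ a) * (\<Sum>xs\<in>?L. w ^ sum_list xs)"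
    using Suc by simp
  also have "\<dots> = (\<Sum>(x, xs)\<in>X \<times> ?L. w ^ sum_list (x # xs))"
    by (simp add: sum_product sum.cartesian_product power_add)
  also have "\<dots> = (\<Sum>xs\<in>{xs. set xs \<subseteq> X \<and> length xs = Suc k}. w ^ sum_list xs)"
    unfolding eq by (subst sum.reindex[OF inj]) (auto intro!: sum.cong)
  finally show ?case .
qed

lemma sum_list_le_length_mult: "set xs \<subseteq> {..H} \<Longrightarrow> sum_list xs \<le> length xs * (H::nat)"
  by (induction xs) auto

lemma tuples_generating_function:
  fixes w :: "'a::comm_semiring_1"
  assumes "X \<subseteq> {..H}"
  shows "(\<Sum>a\<in>X. w ^ a) ^ k = (\<Sum>j\<le>k * H. of_nat (card (tuples k X j)) * w ^ j)"
proof -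
  have fin: "finite X" using assms finite_subset by blast
  have le: "sum_list xs \<le> k * H" if "xs \<in> {xs. set xs \<subseteq> X \<and> length xs = k}" for xs
    using that sum_list_le_length_mult[of xs H] assms by auto
  have "{xs \<in> {xs. set xs \<subseteq> X \<and> length xs = k}. sum_list xs = j} = tuples k X j" for j
    by (auto simp: tuples_def)
  then show ?thesis
    unfolding power_sum_powers_lists[OF fin]
    using sum_power_group[OF finite_lists_length_eq[OF fin] le, where w = w] by simp
qed

text \<open>The doubled entry contributes the sum at \<open>w\<^sup>2\<close>; the other
  \<open>k - 2\<close> entries contribute one factor each.\<close>

lemma twin_tuples_generating_function:
  fixes w :: "'a::comm_semiring_1"
  assumes "X \<subseteq> {..H}" "k \<ge> 2"
  shows "(\<Sum>a\<in>X. (w\<^sup>2) ^ a) * (\<Sum>a\<in>X. w ^ a) ^ (k - 2) =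
    (\<Sum>j\<le>k * H. of_nat (card (twin_tuples k X j)) * w ^ j)"
proof -
  have fin: "finite X" using assms finite_subset by blast
  let ?L = "{xs. set xs \<subseteq> X \<and> length xs = k - 2}"
  let ?f = "\<lambda>(y, zs). 2 * y + sum_list zs"
  have le: "?f p \<le> k * H" if p: "p \<in> X \<times> ?L" for p
  proof -
    obtain y zs where yz: "p = (y, zs)" "y \<le> H" "set zs \<subseteq> {..H}" "length zs = k - 2"
      using assms p by auto
    then have "2 * y + sum_list zs \<le> 2 * H + (k - 2) * H"
      using sum_list_le_length_mult[of zs H] by simp
    also have "\<dots> = (2 + (k - 2)) * H" by (simp only: add_mult_distrib)
    also have "\<dots> = k * H" using assms by (simp only: le_add_diff_inverse)
    finally show ?thesis using yz by simp
  qed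
  have eq: "{p \<in> X \<times> ?L. ?f p = j} = twin_tuples k X j" for j
    by (auto simp: twin_tuples_def)
  have "(\<Sum>a\<in>X. (w\<^sup>2) ^ a) * (\<Sum>a\<in>X. w ^ a) ^ (k - 2) = (\<Sum>p\<in>X \<times> ?L. w ^ ?f p)"
    unfolding power_sum_powers_lists[OF fin]
    by (simp add: sum_product sum.cartesian_product power_add power_mult case_prod_unfold)
  also have "\<dots> = (\<Sum>j\<le>k * H. of_nat (card {p \<in> X \<times> ?L. ?f p = j}) * w ^ j)"
    using fin finite_lists_length_eq[OF fin] le by (intro sum_power_group) auto
  finally show ?thesis unfolding eq .
qed

section \<open>Distinct tuples and tuples with a repeated entry\<close>

lemma card_distinct_tuples:
  "card {xs \<in> tuples k A n. distinct xs} = fact k * rep_count (<) k A n"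
proof -
  \<comment> \<open>A distinct tuple is an arrangement of a set in \<open>F\<close>: each such set
    has \<open>fact k\<close> arrangements, exactly one of them increasing.\<close>
  define F where "F = {X. finite X \<and> card X = k \<and> X \<subseteq> A \<and> \<Sum>X = n}"
  have le: "x \<le> n" if "X \<in> F" "x \<in> X" for X x
    using that member_le_sum[of x X "\<lambda>x. x"] by (auto simp: F_def)
  have finF: "finite F"
    by (rule finite_subset[of _ "Pow {..n}"]) (use le in auto)
  have "{xs \<in> tuples k A n. distinct xs} = (\<Union>X\<in>F. permutations_of_set X)"
  proof (intro equalityI subsetI)
    fix xs assume "xs \<in> {xs \<in> tuples k A n. distinct xs}"
    then have "set xs \<in> F" "xs \<in> permutations_of_set (set xs)"
      by (auto simp: tuples_def F_def distinct_card permutations_of_set_def sum_list_distinct_conv_sum_set)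
        (metis sum_list_distinct_conv_sum_set list.map_ident sum.cong)
    then show "xs \<in> (\<Union>X\<in>F. permutations_of_set X)" by blast
  next
    fix xs assume "xs \<in> (\<Union>X\<in>F. permutations_of_set X)"
    then show "xs \<in> {xs \<in> tuples k A n. distinct xs}"
      by (auto simp: tuples_def F_def distinct_card permutations_of_set_def)
        (metis sum_list_distinct_conv_sum_set list.map_ident sum.cong)
  qed
  then have "card {xs \<in> tuples k A n. distinct xs} = (\<Sum>X\<in>F. card (permutations_of_set X))"
    by (simp only:) (intro card_UN_disjoint finF, auto dest: permutations_of_setD)
  also have "\<dots> = (\<Sum>X\<in>F. fact k)"
    by (intro sum.cong) (auto simp: F_def)
  also have "\<dots> = fact k * card F" by simp
  also have "card F = rep_count (<) k A n"
    unfolding rep_count_def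
  proof (rule bij_betw_same_card[of sorted_list_of_set], rule bij_betw_byWitness[of _ set])
    show "\<forall>X\<in>F. set (sorted_list_of_set X) = X" by (auto simp: F_def)
    show "\<forall>xs\<in>{xs. length xs = k \<and> set xs \<subseteq> A \<and> sorted_wrt (<) xs \<and> sum_list xs = n}.
        sorted_list_of_set (set xs) = xs"
      by (auto simp: sorted_list_of_set.idem_if_sorted_distinct strict_sorted_iff)
    show "sorted_list_of_set ` F \<subseteq> {xs. length xs = k \<and> set xs \<subseteq> A \<and> sorted_wrt (<) xs \<and> sum_list xs = n}"
    proof (intro image_subsetI)
      fix X assume "X \<in> F"
      then have X: "finite X" "card X = k" "X \<subseteq> A" "\<Sum>X = n" by (auto simp: F_def)
      have "sum_list (sorted_list_of_set X) = \<Sum>X"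
        using sum_list_distinct_conv_sum_set[of "sorted_list_of_set X" "\<lambda>x. x"] X by simp
      then show "sorted_list_of_set X \<in> {xs. length xs = k \<and> set xs \<subseteq> A \<and> sorted_wrt (<) xs \<and> sum_list xs = n}"
        using X by simp
    qed
    show "set ` {xs. length xs = k \<and> set xs \<subseteq> A \<and> sorted_wrt (<) xs \<and> sum_list xs = n} \<subseteq> F"
    proof (intro image_subsetI)
      fix xs assume "xs \<in> {xs. length xs = k \<and> set xs \<subseteq> A \<and> sorted_wrt (<) xs \<and> sum_list xs = n}"
      then have xs: "length xs = k" "set xs \<subseteq> A" "distinct xs" "sum_list xs = n"
        by (auto simp: strict_sorted_iff)
      then show "set xs \<in> F"
        using sum_list_distinct_conv_sum_set[of xs "\<lambda>x. x"] by (simp add: F_def distinct_card)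
    qed
  qed
  finally show ?thesis .
qed

text \<open>Two positions of a repeated entry (at most \<open>k\<close> choices each), its value and
  the remaining \<open>k - 2\<close> entries recover the tuple.\<close>

lemma card_nondistinct_tuples_le:
  "card {xs \<in> tuples k A n. \<not> distinct xs} \<le> k\<^sup>2 * card (twin_tuples k A n)"
proof -
  \<comment> \<open>\<open>g\<close> inserts \<open>y\<close> after \<open>p\<close> entries and
    once more after \<open>q\<close> further ones.\<close>
  define g :: "nat \<times> nat \<times> nat \<times> nat list \<Rightarrow> nat list"
    where "g = (\<lambda>(p, q, y, zs). take p zs @ [y] @ take q (drop p zs) @ [y] @ drop q (drop p zs))"
  have "{xs \<in> tuples k A n. \<not> distinct xs} \<subseteq> g ` ({..<k} \<times> {..<k} \<times> twin_tuples k A n)"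
  proof
    fix xs assume xs: "xs \<in> {xs \<in> tuples k A n. \<not> distinct xs}"
    then obtain us vs ws y where eq: "xs = us @ [y] @ vs @ [y] @ ws"
      using not_distinct_decomp by blast
    have "xs = g (length us, length vs, y, us @ vs @ ws)" by (simp add: g_def eq)
    moreover have "(length us, length vs, y, us @ vs @ ws) \<in> {..<k} \<times> {..<k} \<times> twin_tuples k A n"
      using xs eq by (auto simp: tuples_def twin_tuples_def)
    ultimately show "xs \<in> g ` ({..<k} \<times> {..<k} \<times> twin_tuples k A n)" by blast
  qed
  then have "card {xs \<in> tuples k A n. \<not> distinct xs} \<le> card ({..<k} \<times> {..<k} \<times> twin_tuples k A n)"
    by (intro surj_card_le) (auto simp: finite_twin_tuples)
  then show ?thesis by (simp add: card_cartesian_product power2_eq_square)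
qed

lemma rep_count_strict_le: "rep_count (<) k A n \<le> rep_count (\<le>) k A n"
  unfolding rep_count_def
  by (intro card_mono finite_subset[OF _ finite_tuples[of k A n]])
     (auto simp: tuples_def intro: sorted_wrt_mono_rel[of _ "(<)"])

text \<open>A weakly increasing tuple without repetition is strictly increasing.\<close>

lemma rep_count_weak_le:
  "rep_count (\<le>) k A n \<le> rep_count (<) k A n + card {xs \<in> tuples k A n. \<not> distinct xs}"
proof -
  have "{xs. length xs = k \<and> set xs \<subseteq> A \<and> sorted_wrt (\<le>) xs \<and> sum_list xs = n}
     \<subseteq> {xs. length xs = k \<and> set xs \<subseteq> A \<and> sorted_wrt (<) xs \<and> sum_list xs = n}
       \<union> {xs \<in> tuples k A n. \<not> distinct xs}"
    by (auto simp: tuples_def strict_sorted_iff)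
  then show ?thesis
    unfolding rep_count_def
    by (intro order_trans[OF card_mono card_Un_le])
       (auto intro: finite_subset[OF _ finite_tuples[of k A n]] simp: tuples_def)
qed

text \<open>With \<open>d\<close> non-distinct tuples, the ordered count is \<open>fact k\<close>
  times the strict count plus \<open>d\<close>, and the weak count exceeds the strict one by at most
  \<open>d\<close>.\<close>

lemma card_tuples_rep_count_diff:
  assumes "star \<in> {(\<le>), (<)}"
  shows "\<bar>real (card (tuples k A n)) - fact k * real (rep_count star k A n)\<bar>
    \<le> fact k * (real k)\<^sup>2 * real (card (twin_tuples k A n))"
proof -
  define d where "d = card {xs \<in> tuples k A n. \<not> distinct xs}"
  have "card (tuples k A n) = card {xs \<in> tuples k A n. distinct xs} + d"
    unfolding d_def
    by (subst card_Un_disjoint[symmetric])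
       (auto intro: finite_subset[OF _ finite_tuples] arg_cong[where f = card])
  then have R: "real (card (tuples k A n)) = fact k * real (rep_count (<) k A n) + real d"
    by (simp add: card_distinct_tuples)
  have d: "real d \<le> (real k)\<^sup>2 * real (card (twin_tuples k A n))"
    unfolding d_def using card_nondistinct_tuples_le[of k A n]
    by (metis of_nat_le_iff of_nat_mult of_nat_power)
  have f1: "1 \<le> (fact k :: real)" by simp
  have "\<bar>real (card (tuples k A n)) - fact k * real (rep_count star k A n)\<bar> \<le> fact k * real d"
  proof (cases "star = (<)")
    case True
    have "real d \<le> fact k * real d" using f1 mult_right_mono[of 1 "fact k" "real d"] by simp
    then show ?thesis using True R by simp
  next
    case False
    then have s: "star = (\<le>)" using assms by simp
    define u where "u = real (rep_count (\<le>) k A n) - real (rep_count (<) k A n)"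
    have u: "0 \<le> u" "u \<le> real d"
      using rep_count_strict_le[of k A n] rep_count_weak_le[of k A n]
      unfolding u_def d_def by linarith+
    have "real (card (tuples k A n)) - fact k * real (rep_count star k A n) = real d - fact k * u"
      unfolding R s u_def by (simp add: algebra_simps)
    moreover have "0 \<le> fact k * u" "fact k * u \<le> fact k * real d" "real d \<le> fact k * real d"
      using u f1 mult_right_mono[of 1 "fact k" "real d"] by (simp_all add: mult_left_mono)
    ultimately show ?thesis by linarith
  qed
  also have "\<dots> \<le> fact k * ((real k)\<^sup>2 * real (card (twin_tuples k A n)))"
    using d by (intro mult_left_mono) auto
  finally show ?thesis by (simp add: mult.assoc)
qed

section \<open>Ordered and unordered representations\<close>

text \<open>For nonnegative \<open>g\<close> this says that the averages of \<open>g\<close> tend to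
  0. The constant \<open>K\<close> may depend on \<open>\<epsilon>\<close> and absorbs small
  \<open>n\<close>, which avoids division by \<open>n\<close>.\<close>

definition mean_null :: "(nat \<Rightarrow> real) \<Rightarrow> bool" where
  "mean_null g \<longleftrightarrow> (\<forall>\<epsilon>>0. \<exists>K. \<forall>n. (\<Sum>j\<le>n. g j) \<le> \<epsilon> * real n + K)"

lemma mean_null_mono:
  assumes "mean_null g" "\<And>j. f j \<le> g j"
  shows "mean_null f"
  unfolding mean_null_def
  using assms by (meson mean_null_def order_trans sum_mono)

lemma mean_null_add:
  assumes "mean_null f" "mean_null g"
  shows "mean_null (\<lambda>j. f j + g j)"
  unfolding mean_null_def
proof (intro allI impI)
  fix \<epsilon> :: real assume "\<epsilon> > 0"
  then have e: "\<epsilon> / 2 > 0" by simp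
  obtain K where K: "\<And>n. (\<Sum>j\<le>n. f j) \<le> \<epsilon> / 2 * real n + K"
    using assms(1) e unfolding mean_null_def by blast
  obtain L where L: "\<And>n. (\<Sum>j\<le>n. g j) \<le> \<epsilon> / 2 * real n + L"
    using assms(2) e unfolding mean_null_def by blast
  have "(\<Sum>j\<le>n. f j + g j) \<le> \<epsilon> * real n + (K + L)" for n
    using K[of n] L[of n] by (simp add: sum.distrib)
  then show "\<exists>K. \<forall>n. (\<Sum>j\<le>n. f j + g j) \<le> \<epsilon> * real n + K" by blast
qed

lemma mean_null_cmult:
  assumes "mean_null f" "b \<ge> 0"
  shows "mean_null (\<lambda>j. b * f j)"
  unfolding mean_null_def
proof (intro allI impI)
  fix \<epsilon> :: real assume e: "\<epsilon> > 0"
  \<comment> \<open>The summand 1 guards against \<open>b = 0\<close>.\<close>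
  then have "\<epsilon> / (b + 1) > 0" using assms by simp
  then obtain K where K: "\<And>n. (\<Sum>j\<le>n. f j) \<le> \<epsilon> / (b + 1) * real n + K"
    using assms(1) unfolding mean_null_def by blast
  have "(\<Sum>j\<le>n. b * f j) \<le> \<epsilon> * real n + b * K" for n
  proof -
    have "(\<Sum>j\<le>n. b * f j) \<le> b * (\<epsilon> / (b + 1) * real n + K)"
      using K[of n] assms by (simp add: mult_left_mono flip: sum_distrib_left)
    also have "\<dots> = \<epsilon> * real n * (b / (b + 1)) + b * K" by (simp add: algebra_simps)
    also have "\<dots> \<le> \<epsilon> * real n * 1 + b * K"
      using e assms by (intro add_mono mult_left_mono) auto
    finally show ?thesis by simp
  qed
  then show "\<exists>K. \<forall>n. (\<Sum>j\<le>n. b * f j) \<le> \<epsilon> * real n + K" by blast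
qed

section \<open>Mean square of the twin counts\<close>

lemma mult_power_sq_le:
  fixes x y s :: real
  assumes "x \<ge> 0" "y \<ge> 0" "s > 0" "k \<ge> 2"
  shows "(y * x ^ (k - 2))\<^sup>2 \<le> s\<^sup>2 * (x ^ k)\<^sup>2 + (1 / s) ^ (k - 2) * y ^ k"
proof -
  obtain m where k: "k = m + 2" using assms by (metis add.commute le_Suc_ex)
  show ?thesis
  \<comment> \<open>Below the threshold \<open>y\<close> is replaced by
    \<open>s * x\<^sup>2\<close>; above it \<open>x\<^sup>2\<close> is replaced by
    \<open>y / s\<close>, which leaves only powers of \<open>y\<close>.\<close>
  proof (cases "y \<le> s * x\<^sup>2")
    case True
    have "y * x ^ m \<le> s * x\<^sup>2 * x ^ m" using True assms by (intro mult_right_mono) auto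
    then have "(y * x ^ m)\<^sup>2 \<le> (s * x\<^sup>2 * x ^ m)\<^sup>2" using assms by (intro power_mono) auto
    also have "\<dots> = s\<^sup>2 * (x ^ k)\<^sup>2" by (simp add: k power_mult_distrib power_add mult_ac)
    finally show ?thesis using assms by (simp add: k add_increasing2)
  next
    case False
    then have "x\<^sup>2 \<le> y / s" using assms by (simp add: field_simps)
    then have "(x\<^sup>2) ^ m \<le> (y / s) ^ m" by (intro power_mono) auto
    then have "y\<^sup>2 * (x\<^sup>2) ^ m \<le> y\<^sup>2 * (y / s) ^ m" by (intro mult_left_mono) auto
    also have "\<dots> = (1 / s) ^ m * y ^ k" by (simp add: k power_add power_divide field_simps power2_eq_square)
    finally have "(y * x ^ m)\<^sup>2 \<le> (1 / s) ^ m * y ^ k"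
      by (simp add: power_mult_distrib mult.commute flip: power_mult)
    then show ?thesis by (simp add: k add_increasing)
  qed
qed

text \<open>By Parseval both sums are circle means. The preceding inequality is applied with
  \<open>x = cmod (f z)\<close> and \<open>y = cmod (f (z\<^sup>2))\<close>; the mean of
  \<open>y ^ k\<close> equals that of \<open>x ^ k\<close>, at most \<open>sqrt J\<close>. A small
  \<open>s\<close> makes this a small multiple of \<open>J\<close> plus a lower order term.\<close>

lemma twin_energy_le:
  fixes s :: real
  assumes X: "X \<subseteq> {..H}" and k: "k \<ge> 2" and s: "s > 0"
  defines "J \<equiv> (\<Sum>j\<le>k * H. (real (card (tuples k X j)))\<^sup>2)"
  shows "(\<Sum>j\<le>k * H. (real (card (twin_tuples k X j)))\<^sup>2) \<le> s\<^sup>2 * J + (1 / s) ^ (k - 2) * sqrt J"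
proof -
  \<comment> \<open>\<open>Q\<close> exceeds the degree \<open>k * H\<close> and is odd, so that
    squaring permutes the roots.\<close>
  define Q where "Q = 2 * (k * H) + 1"
  define f :: "complex \<Rightarrow> complex" where "f z = (\<Sum>a\<in>X. z ^ a)" for z
  have Q: "k * H < Q" "odd Q" by (auto simp: Q_def)
  have "J = circle_mean Q (\<lambda>z. (cmod (\<Sum>j\<le>k * H. of_real (real (card (tuples k X j))) * z ^ j))\<^sup>2)"
    unfolding J_def circle_mean_parseval[OF Q(1)] ..
  then have J: "J = circle_mean Q (\<lambda>z. (cmod (f z) ^ k)\<^sup>2)"
    by (simp add: f_def norm_power[symmetric] tuples_generating_function[OF X])
  have "(\<Sum>j\<le>k * H. (real (card (twin_tuples k X j)))\<^sup>2)
      = circle_mean Q (\<lambda>z. (cmod (\<Sum>j\<le>k * H. of_real (real (card (twin_tuples k X j))) * z ^ j))\<^sup>2)"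
    unfolding circle_mean_parseval[OF Q(1)] ..
  also have "\<dots> = circle_mean Q (\<lambda>z. (cmod (f (z\<^sup>2)) * cmod (f z) ^ (k - 2))\<^sup>2)"
    by (simp add: f_def norm_power[symmetric] norm_mult[symmetric] twin_tuples_generating_function[OF X k])
  also have "\<dots> \<le> circle_mean Q (\<lambda>z. s\<^sup>2 * (cmod (f z) ^ k)\<^sup>2 + (1 / s) ^ (k - 2) * cmod (f (z\<^sup>2)) ^ k)"
    using s k by (intro circle_mean_mono mult_power_sq_le) auto
  also have "\<dots> = s\<^sup>2 * J + (1 / s) ^ (k - 2) * circle_mean Q (\<lambda>z. cmod (f (z\<^sup>2)) ^ k)"
    unfolding circle_mean_add circle_mean_cmult J ..
  also have "circle_mean Q (\<lambda>z. cmod (f (z\<^sup>2)) ^ k) = circle_mean Q (\<lambda>z. cmod (f z) ^ k)"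
    using circle_mean_square_arg[OF Q(2), of "\<lambda>z. cmod (f z) ^ k"] .
  also have "s\<^sup>2 * J + (1 / s) ^ (k - 2) * circle_mean Q (\<lambda>z. cmod (f z) ^ k)
      \<le> s\<^sup>2 * J + (1 / s) ^ (k - 2) * sqrt J"
    unfolding J using s circle_mean_le_sqrt by (intro add_left_mono mult_left_mono) auto
  finally show ?thesis .
qed

lemma sq_add_le: "(a + b)\<^sup>2 \<le> 2 * a\<^sup>2 + 2 * (b::real)\<^sup>2"
  using sum_squares_bound[of a b] by (simp add: power2_sum)

text \<open>Completing the square; with \<open>q = sqrt J\<close> this absorbs lower order terms
  into a small multiple of \<open>J\<close>.\<close>

lemma young_linear:
  fixes G q \<delta> :: real
  assumes "\<delta> > 0"
  shows "G * q \<le> \<delta> * q\<^sup>2 + G\<^sup>2 / (4 * \<delta>)"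
proof -
  have "0 \<le> (2 * \<delta> * q - G)\<^sup>2 / (4 * \<delta>)" using assms by simp
  also have "\<dots> = \<delta> * q\<^sup>2 + G\<^sup>2 / (4 * \<delta>) - G * q"
    using assms by (simp add: power2_eq_square field_simps)
  finally show ?thesis by simp
qed

lemma rep_count_mono:
  assumes "star \<in> {(\<le>), (<)}" "X \<subseteq> A"
  shows "rep_count star k X n \<le> rep_count star k A n"
  unfolding rep_count_def
  by (intro card_mono finite_subset[OF _ finite_tuples[of k A n]])
     (use assms in \<open>auto simp: tuples_def\<close>)

text \<open>A self-improving estimate: the energy \<open>J\<close> is bounded by the given sum for
  \<open>rep_count\<close> plus a multiple of the twin energy, which is itself a small fraction of
  \<open>J\<close> plus a multiple of \<open>sqrt J\<close>.\<close>

lemma tuples_energy_linear: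
  assumes star: "star \<in> {(\<le>), (<)}" and k: "k \<ge> 2" and B: "B \<ge> 0"
    and r: "\<And>n. (\<Sum>j\<le>n. (real (rep_count star k A j))\<^sup>2) \<le> B * (real n + 1)"
  obtains C where "C \<ge> 0"
    "\<And>H. (\<Sum>j\<le>k * H. (real (card (tuples k (A \<inter> {..H}) j)))\<^sup>2) \<le> C * (real H + 1)"
proof -
  define D :: real where "D = fact k * (real k)\<^sup>2"
  define G where "G = 2 * D\<^sup>2 * (2 * D) ^ (k - 2)"
  define C where "C = 8 * (fact k)\<^sup>2 * B * real k + 4 * G\<^sup>2"
  have D: "D > 0" using k by (simp add: D_def)
  have "(\<Sum>j\<le>k * H. (real (card (tuples k (A \<inter> {..H}) j)))\<^sup>2) \<le> C * (real H + 1)" for H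
  proof -
    define X where "X = A \<inter> {..H}"
    define J where "J = (\<Sum>j\<le>k * H. (real (card (tuples k X j)))\<^sup>2)"
    define W where "W = (\<Sum>j\<le>k * H. (real (card (twin_tuples k X j)))\<^sup>2)"
    have X: "X \<subseteq> {..H}" "X \<subseteq> A" by (auto simp: X_def)
    have J0: "J \<ge> 0" unfolding J_def by (intro sum_nonneg) auto
    have "(real (card (tuples k X j)))\<^sup>2
        \<le> 2 * (fact k)\<^sup>2 * (real (rep_count star k A j))\<^sup>2 + 2 * D\<^sup>2 * (real (card (twin_tuples k X j)))\<^sup>2" for j
    proof -
      have "real (card (tuples k X j)) \<le> fact k * real (rep_count star k X j) + D * real (card (twin_tuples k X j))"
        using card_tuples_rep_count_diff[OF star, of k X j] unfolding D_def by linarith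
      also have "\<dots> \<le> fact k * real (rep_count star k A j) + D * real (card (twin_tuples k X j))"
        using rep_count_mono[OF star X(2), of k j] by (simp add: mult_left_mono)
      finally have "(real (card (tuples k X j)))\<^sup>2
          \<le> (fact k * real (rep_count star k A j) + D * real (card (twin_tuples k X j)))\<^sup>2"
        by (intro power_mono) auto
      also note sq_add_le
      finally show ?thesis by (simp add: power_mult_distrib mult.assoc)
    qed
    then have "J \<le> (\<Sum>j\<le>k * H. 2 * (fact k)\<^sup>2 * (real (rep_count star k A j))\<^sup>2
        + 2 * D\<^sup>2 * (real (card (twin_tuples k X j)))\<^sup>2)"
      unfolding J_def by (intro sum_mono)
    also have "\<dots> = 2 * (fact k)\<^sup>2 * (\<Sum>j\<le>k * H. (real (rep_count star k A j))\<^sup>2) + 2 * D\<^sup>2 * W"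
      by (simp add: sum.distrib W_def sum_distrib_left)
    also have "\<dots> \<le> 2 * (fact k)\<^sup>2 * (B * (real k * (real H + 1))) + 2 * D\<^sup>2 * ((1 / (2 * D))\<^sup>2 * J + (2 * D) ^ (k - 2) * sqrt J)"
    proof (intro add_mono mult_left_mono)
      have "(\<Sum>j\<le>k * H. (real (rep_count star k A j))\<^sup>2) \<le> B * (real (k * H) + 1)" by (rule r)
      also have "\<dots> \<le> B * (real k * (real H + 1))"
        using k B by (intro mult_left_mono) (auto simp: algebra_simps)
      finally show "(\<Sum>j\<le>k * H. (real (rep_count star k A j))\<^sup>2) \<le> B * (real k * (real H + 1))" .
      \<comment> \<open>The choice \<open>s = 1 / (2 * D)\<close> turns
        \<open>2 * D\<^sup>2 * s\<^sup>2 * J\<close> into \<open>J / 2\<close>.\<close>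
      show "W \<le> (1 / (2 * D))\<^sup>2 * J + (2 * D) ^ (k - 2) * sqrt J"
        using twin_energy_le[OF X(1) k, of "1 / (2 * D)"] D unfolding J_def W_def by simp
    qed auto
    also have "\<dots> = 2 * (fact k)\<^sup>2 * B * real k * (real H + 1) + J / 2 + G * sqrt J"
      using D by (simp add: G_def power2_eq_square field_simps)
    \<comment> \<open>Now \<open>3 / 4\<close> of \<open>J\<close> stands on the right; moving it to
      the left multiplies the other terms by 4.\<close>
    also have "G * sqrt J \<le> J / 4 + G\<^sup>2"
      using young_linear[of "1/4" G "sqrt J"] J0 by simp
    finally have "J \<le> 8 * (fact k)\<^sup>2 * B * real k * (real H + 1) + 4 * G\<^sup>2" by simp
    also have "\<dots> \<le> C * (real H + 1)" by (simp add: C_def algebra_simps)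
    finally show ?thesis by (simp add: J_def X_def)
  qed
  moreover have "C \<ge> 0" using B by (simp add: C_def)
  ultimately show ?thesis using that by blast
qed

text \<open>The truncated energy \<open>J\<close> grows at most linearly, and
  \<open>twin_energy_le\<close> with \<open>s = sqrt \<delta>\<close> bounds the twin energy by
  \<open>2 * \<delta> * J\<close> plus a constant.\<close>

lemma twin_tuples_mean_null:
  assumes star: "star \<in> {(\<le>), (<)}" and k: "k \<ge> 2" and B: "B \<ge> 0"
    and r: "\<And>n. (\<Sum>j\<le>n. (real (rep_count star k A j))\<^sup>2) \<le> B * (real n + 1)"
  shows "mean_null (\<lambda>j. (real (card (twin_tuples k A j)))\<^sup>2)"
  unfolding mean_null_def
proof (intro allI impI)
  fix \<epsilon> :: real assume e: "\<epsilon> > 0"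
  obtain C where C: "C \<ge> 0"
    and J: "\<And>H. (\<Sum>j\<le>k * H. (real (card (tuples k (A \<inter> {..H}) j)))\<^sup>2) \<le> C * (real H + 1)"
    using tuples_energy_linear[OF star k B r] by blast
  \<comment> \<open>Chosen so that each of the two terms \<open>\<delta> * J\<close> is at most
    \<open>\<epsilon> / 2 * (n + 1)\<close>.\<close>
  define \<delta> where "\<delta> = \<epsilon> / (2 * (C + 1))"
  define G where "G = (1 / sqrt \<delta>) ^ (k - 2)"
  have d: "\<delta> > 0" using e C by (simp add: \<delta>_def)
  have dC: "\<delta> * C \<le> \<epsilon> / 2" using e C by (simp add: \<delta>_def field_simps)
  have "(\<Sum>j\<le>n. (real (card (twin_tuples k A j)))\<^sup>2) \<le> \<epsilon> * real n + (\<epsilon> + G\<^sup>2 / (4 * \<delta>))" for n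
  proof -
    define X where "X = A \<inter> {..n}"
    define J where "J = (\<Sum>j\<le>k * n. (real (card (tuples k X j)))\<^sup>2)"
    have J0: "J \<ge> 0" unfolding J_def by (intro sum_nonneg) auto
    have "(\<Sum>j\<le>n. (real (card (twin_tuples k A j)))\<^sup>2) = (\<Sum>j\<le>n. (real (card (twin_tuples k X j)))\<^sup>2)"
      by (simp add: X_def twin_tuples_truncate)
    also have "\<dots> \<le> (\<Sum>j\<le>k * n. (real (card (twin_tuples k X j)))\<^sup>2)"
      using k by (intro sum_mono2) auto
    also have "\<dots> \<le> (sqrt \<delta>)\<^sup>2 * J + G * sqrt J"
      unfolding J_def G_def using d k by (intro twin_energy_le) (auto simp: X_def)
    also have "\<dots> \<le> \<delta> * J + (\<delta> * J + G\<^sup>2 / (4 * \<delta>))"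
      using young_linear[OF d, of G "sqrt J"] J0 d by (simp add: mult.commute)
    also have "\<dots> = 2 * (\<delta> * J) + G\<^sup>2 / (4 * \<delta>)" by simp
    also have "\<delta> * J \<le> \<delta> * (C * (real n + 1))"
      using J[of n] d by (simp add: J_def X_def)
    also have "\<dots> \<le> \<epsilon> / 2 * (real n + 1)"
      using mult_right_mono[OF dC, of "real n + 1"] by (simp add: mult_ac)
    finally show ?thesis by (simp add: field_simps)
  qed
  then show "\<exists>K. \<forall>n. (\<Sum>j\<le>n. (real (card (twin_tuples k A j)))\<^sup>2) \<le> \<epsilon> * real n + K" by blast
qed

text \<open>The error of the ordered count is at most \<open>fact k\<close> times the given error
  plus a multiple of the twin count; both have vanishing mean square.\<close>

lemma tuples_error_mean_null:
  assumes star: "star \<in> {(\<le>), (<)}" and k: "k \<ge> 2"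
    and err: "mean_null (\<lambda>j. (real (rep_count star k A j) - c)\<^sup>2)"
  shows "mean_null (\<lambda>j. (real (card (tuples k A j)) - fact k * c)\<^sup>2)"
proof -
  define D :: real where "D = fact k * (real k)\<^sup>2"
  \<comment> \<open>The instance \<open>\<epsilon> = 1\<close> makes the sum of the squared counts
    grow at most linearly.\<close>
  obtain K where K: "\<And>n. (\<Sum>j\<le>n. (real (rep_count star k A j) - c)\<^sup>2) \<le> 1 * real n + K"
    using err unfolding mean_null_def by (meson zero_less_one)
  define B where "B = 2 * c\<^sup>2 + 2 + 2 * \<bar>K\<bar>"
  have "(\<Sum>j\<le>n. (real (rep_count star k A j))\<^sup>2) \<le> B * (real n + 1)" for n
  proof -
    have "(\<Sum>j\<le>n. (real (rep_count star k A j))\<^sup>2) \<le> (\<Sum>j\<le>n. 2 * c\<^sup>2 + 2 * (real (rep_count star k A j) - c)\<^sup>2)"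
    proof (intro sum_mono)
      fix j
      show "(real (rep_count star k A j))\<^sup>2 \<le> 2 * c\<^sup>2 + 2 * (real (rep_count star k A j) - c)\<^sup>2"
        using sq_add_le[of c "real (rep_count star k A j) - c"] by simp
    qed
    also have "\<dots> = 2 * c\<^sup>2 * (real n + 1) + 2 * (\<Sum>j\<le>n. (real (rep_count star k A j) - c)\<^sup>2)"
      by (simp add: sum.distrib sum_distrib_left algebra_simps)
    also have "\<dots> \<le> 2 * c\<^sup>2 * (real n + 1) + 2 * (real n + K)" using K[of n] by simp
    also have "\<dots> \<le> 2 * c\<^sup>2 * (real n + 1) + 2 * (real n + 1) + 2 * \<bar>K\<bar> * (real n + 1)"
      by (simp add: algebra_simps) (smt (verit) mult_nonneg_nonneg of_nat_0_le_iff abs_ge_zero)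
    finally show ?thesis by (simp add: B_def algebra_simps)
  qed
  then have W: "mean_null (\<lambda>j. (real (card (twin_tuples k A j)))\<^sup>2)"
    using twin_tuples_mean_null[OF star k, of B] by (simp add: B_def)
  have "mean_null (\<lambda>j. 2 * (fact k)\<^sup>2 * (real (rep_count star k A j) - c)\<^sup>2
      + 2 * D\<^sup>2 * (real (card (twin_tuples k A j)))\<^sup>2)"
    by (intro mean_null_add mean_null_cmult err W) auto
  then show ?thesis
  proof (rule mean_null_mono)
    fix j
    have "\<bar>real (card (tuples k A j)) - fact k * c\<bar>
        \<le> fact k * \<bar>real (rep_count star k A j) - c\<bar> + D * real (card (twin_tuples k A j))"
    proof -
      have "fact k * \<bar>real (rep_count star k A j) - c\<bar> = \<bar>fact k * real (rep_count star k A j) - fact k * c\<bar>"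
        by (simp add: abs_mult flip: right_diff_distrib)
      then show ?thesis
        using card_tuples_rep_count_diff[OF star, of k A j] unfolding D_def by linarith
    qed
    then have "\<bar>real (card (tuples k A j)) - fact k * c\<bar>\<^sup>2
        \<le> (fact k * \<bar>real (rep_count star k A j) - c\<bar> + D * real (card (twin_tuples k A j)))\<^sup>2"
      by (intro power_mono) auto
    also note sq_add_le
    finally show "(real (card (tuples k A j)) - fact k * c)\<^sup>2
        \<le> 2 * (fact k)\<^sup>2 * (real (rep_count star k A j) - c)\<^sup>2 + 2 * D\<^sup>2 * (real (card (twin_tuples k A j)))\<^sup>2"
      by (simp add: power_mult_distrib mult.assoc)
  qed
qed

section \<open>The generating function near the unit circle\<close>

lemma abel_summation:
  fixes g :: "nat \<Rightarrow> real"
  shows "(\<Sum>j\<le>n. g j * x ^ j) = (\<Sum>j\<le>n. g j) * x ^ n + (1 - x) * (\<Sum>j<n. (\<Sum>i\<le>j. g i) * x ^ j)"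
  by (induction n) (simp_all add: algebra_simps)

lemma sum_powers_le:
  fixes x :: real
  assumes "0 \<le> x" "x < 1"
  shows "(\<Sum>j\<le>n. x ^ j) \<le> 1 / (1 - x)"
proof -
  have "(\<Sum>j\<le>n. x ^ j) = (1 - x ^ Suc n) / (1 - x)"
    using assms sum_gp0[of x n] by simp
  also have "\<dots> \<le> 1 / (1 - x)" using assms by (intro divide_right_mono) auto
  finally show ?thesis .
qed

text \<open>For \<open>0 \<le> x < 1\<close> Abel summation writes the weighted sum as a combination
  of partial sums with nonnegative coefficients, so it is monotone in them.\<close>

lemma weighted_sum_le:
  fixes g :: "nat \<Rightarrow> real"
  assumes x: "0 \<le> x" "x < 1" and \<epsilon>: "\<epsilon> \<ge> 0"
    and g: "\<And>n. (\<Sum>j\<le>n. g j) \<le> \<epsilon> * real n + K"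
  shows "(\<Sum>j\<le>n. g j * x ^ j) \<le> K + \<epsilon> / (1 - x)"
proof -
  \<comment> \<open>The sequence whose partial sums attain the bound exactly.\<close>
  define g' where "g' j = (if j = 0 then K else \<epsilon>)" for j :: nat
  have G': "(\<Sum>j\<le>n. g' j) = \<epsilon> * real n + K" for n
    by (induction n) (simp_all add: g'_def algebra_simps)
  have "(\<Sum>j\<le>n. g j * x ^ j) \<le> (\<Sum>j\<le>n. g' j * x ^ j)"
    unfolding abel_summation G' using x g
    by (intro add_mono mult_left_mono mult_right_mono sum_mono) auto
  also have "\<dots> \<le> (\<Sum>j\<le>n. K * of_bool (j = 0) + \<epsilon> * x ^ j)"
    using x \<epsilon> by (intro sum_mono) (auto simp: g'_def)
  also have "\<dots> = K + \<epsilon> * (\<Sum>j\<le>n. x ^ j)"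
    by (simp add: sum.distrib of_bool_def flip: sum_distrib_left)
  also have "\<dots> \<le> K + \<epsilon> / (1 - x)"
    using mult_left_mono[OF sum_powers_le[OF x, of n] \<epsilon>] by simp
  finally show ?thesis .
qed

text \<open>Averaging over \<open>L\<close>: the pairs \<open>(m, m + L)\<close> are distinct
  elements of \<open>X \<times> X\<close>, so all \<open>M\<close> correlations together are at most
  the square of the sum over \<open>X\<close>.\<close>

lemma exists_small_correlation:
  fixes \<rho> :: real
  assumes X: "finite X" and \<rho>: "0 \<le> \<rho>" "\<rho> \<le> 1" and M: "M \<ge> 1"
  shows "\<exists>L\<in>{1..M}. real M * (\<Sum>m\<in>{m\<in>X. m + L \<in> X}. \<rho> ^ (2 * (m + L))) \<le> (\<Sum>a\<in>X. \<rho> ^ a)\<^sup>2"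
proof (rule ccontr)
  define corr where "corr L = (\<Sum>m\<in>{m\<in>X. m + L \<in> X}. \<rho> ^ (2 * (m + L)))" for L
  define T where "T = (\<Sum>a\<in>X. \<rho> ^ a)"
  assume "\<not> ?thesis"
  then have lt: "T\<^sup>2 < real M * corr L" if "L \<in> {1..M}" for L
    using that by (auto simp: corr_def T_def not_le)
  let ?D = "Sigma {1..M} (\<lambda>L. {m\<in>X. m + L \<in> X})"
  have "real M * T\<^sup>2 = (\<Sum>L\<in>{1..M}. T\<^sup>2)" by simp
  also have "\<dots> < (\<Sum>L\<in>{1..M}. real M * corr L)" using lt M by (intro sum_strict_mono) auto
  also have "\<dots> = real M * (\<Sum>L\<in>{1..M}. corr L)" by (simp add: sum_distrib_left)
  finally have "T\<^sup>2 < (\<Sum>L\<in>{1..M}. corr L)" using M by simp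
  also have "\<dots> = (\<Sum>(L, m)\<in>?D. \<rho> ^ (2 * (m + L)))"
    unfolding corr_def using X by (intro sum.Sigma) auto
  also have "\<dots> \<le> (\<Sum>(L, m)\<in>?D. \<rho> ^ m * \<rho> ^ (m + L))"
  proof (intro sum_mono, clarify)
    fix L m
    \<comment> \<open>Lowering the exponent by \<open>L\<close> makes the weight a product over the
      pair.\<close>
    have "\<rho> ^ (2 * (m + L)) \<le> \<rho> ^ (m + (m + L))" using \<rho> by (intro power_decreasing) auto
    then show "\<rho> ^ (2 * (m + L)) \<le> \<rho> ^ m * \<rho> ^ (m + L)" by (simp add: power_add)
  qed
  also have "\<dots> = (\<Sum>(m, n)\<in>(\<lambda>(L, m). (m, m + L)) ` ?D. \<rho> ^ m * \<rho> ^ n)"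
    by (subst sum.reindex) (auto simp: inj_on_def intro!: sum.cong)
  also have "\<dots> \<le> (\<Sum>(m, n)\<in>X \<times> X. \<rho> ^ m * \<rho> ^ n)"
    using X \<rho> by (intro sum_mono2) auto
  also have "\<dots> = T\<^sup>2"
    by (simp add: T_def power2_eq_square sum_product sum.cartesian_product)
  finally show False by simp
qed

text \<open>By Parseval the mean is the energy of \<open>X\<close> plus that of its shift
  \<open>Y\<close> minus twice the correlation; the energy of \<open>Y\<close> is dropped.\<close>

lemma circle_mean_shift_difference:
  fixes \<rho> :: real
  assumes X: "X \<subseteq> {..H}" and Q: "H + L < Q" and \<rho>: "0 \<le> \<rho>"
  shows "circle_mean Q (\<lambda>z. (cmod ((\<Sum>a\<in>X. (of_real \<rho> * z) ^ a) * (1 - (of_real \<rho> * z) ^ L)))\<^sup>2)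
    \<ge> (\<Sum>a\<in>X. \<rho> ^ (2 * a)) - 2 * (\<Sum>m\<in>{m\<in>X. m + L \<in> X}. \<rho> ^ (2 * (m + L)))"
proof -
  define Y where "Y = (\<lambda>a. a + L) ` X"
  define b where "b j = \<rho> ^ j * (of_bool (j \<in> X) - of_bool (j \<in> Y))" for j
  let ?n = "H + L"
  have sub: "{..?n} \<inter> X = X" "{..?n} \<inter> Y = Y" "{..?n} \<inter> (X \<inter> Y) = X \<inter> Y" using X by (auto simp: Y_def)
  have pol: "(\<Sum>a\<in>X. (of_real \<rho> * z) ^ a) * (1 - (of_real \<rho> * z) ^ L) = (\<Sum>j\<le>?n. of_real (b j) * z ^ j)"
    for z :: complex
  proof -
    define w where "w = of_real \<rho> * z"
    have "(\<Sum>j\<le>?n. of_real (b j) * z ^ j)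
        = (\<Sum>j\<le>?n. of_bool (j \<in> X) * w ^ j) - (\<Sum>j\<le>?n. of_bool (j \<in> Y) * w ^ j)"
      unfolding sum_subtractf[symmetric]
      by (intro sum.cong refl) (simp add: b_def w_def power_mult_distrib algebra_simps)
    also have "\<dots> = (\<Sum>j\<in>X. w ^ j) - (\<Sum>j\<in>Y. w ^ j)" by (simp add: sub)
    also have "(\<Sum>j\<in>Y. w ^ j) = (\<Sum>a\<in>X. w ^ a) * w ^ L"
      unfolding Y_def by (subst sum.reindex) (auto simp: inj_on_def power_add sum_distrib_right)
    finally show ?thesis by (simp add: w_def right_diff_distrib)
  qed
  have XY: "X \<inter> Y = (\<lambda>m. m + L) ` {m\<in>X. m + L \<in> X}" by (auto simp: Y_def)
  have "(\<Sum>m\<in>{m\<in>X. m + L \<in> X}. \<rho> ^ (2 * (m + L))) = (\<Sum>j\<in>X \<inter> Y. \<rho> ^ (2 * j))"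
    unfolding XY by (subst sum.reindex) (auto simp: inj_on_def)
  then have "(\<Sum>a\<in>X. \<rho> ^ (2 * a)) - 2 * (\<Sum>m\<in>{m\<in>X. m + L \<in> X}. \<rho> ^ (2 * (m + L)))
     = (\<Sum>j\<le>?n. of_bool (j \<in> X) * \<rho> ^ (2 * j)) - 2 * (\<Sum>j\<le>?n. of_bool (j \<in> X \<inter> Y) * \<rho> ^ (2 * j))"
    using sub by (simp add: Collect_conj_eq)
  also have "\<dots> = (\<Sum>j\<le>?n. of_bool (j \<in> X) * \<rho> ^ (2 * j) - 2 * (of_bool (j \<in> X \<inter> Y) * \<rho> ^ (2 * j)))"
    by (simp only: sum_subtractf sum_distrib_left)
  also have "\<dots> \<le> (\<Sum>j\<le>?n. (b j)\<^sup>2)"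
    using \<rho> by (intro sum_mono) (auto simp: b_def power_mult power_mult_distrib power2_eq_square of_bool_def)
  also have "\<dots> = circle_mean Q (\<lambda>z. (cmod (\<Sum>j\<le>?n. of_real (b j) * z ^ j))\<^sup>2)"
    using circle_mean_parseval[OF Q, of b] by simp
  finally show ?thesis unfolding pol .
qed

text \<open>A power mean inequality; a loss of a factor in the constant allows a proof by truncation at \<open>l\<close>.\<close>

lemma circle_mean_power_ge:
  assumes Q: "Q > 0" and F: "\<And>z. F z \<ge> 0" and k: "k \<ge> 2" and l: "l \<ge> 0"
    and m: "circle_mean Q (\<lambda>z. (F z)\<^sup>2) \<ge> 2 * l\<^sup>2"
  shows "circle_mean Q (\<lambda>z. F z ^ k) \<ge> l ^ k"
proof -
  obtain i where i: "k = i + 2" using k by (metis add.commute le_Suc_ex)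
  \<comment> \<open>The pointwise bound to be averaged is
    \<open>l ^ i * ((F z)\<^sup>2 - l\<^sup>2) \<le> F z ^ k\<close>, whose left side is nonpositive
    where \<open>F z < l\<close>.\<close>
  have "l ^ k = l ^ i * (2 * l\<^sup>2 + - l\<^sup>2)" by (simp add: i power_add power2_eq_square)
  also have "\<dots> \<le> l ^ i * (circle_mean Q (\<lambda>z. (F z)\<^sup>2) + - l\<^sup>2)"
    using m l by (intro mult_left_mono) auto
  also have "\<dots> = circle_mean Q (\<lambda>z. l ^ i * ((F z)\<^sup>2 + - l\<^sup>2))"
    by (simp only: circle_mean_cmult circle_mean_add circle_mean_const[OF Q])
  also have "\<dots> \<le> circle_mean Q (\<lambda>z. F z ^ k)"
  proof (rule circle_mean_mono)
    fix z
    show "l ^ i * ((F z)\<^sup>2 + - l\<^sup>2) \<le> F z ^ k"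
    proof (cases "l \<le> F z")
      case True
      have "l ^ i * ((F z)\<^sup>2 + - l\<^sup>2) \<le> l ^ i * (F z)\<^sup>2" using l by (intro mult_left_mono) auto
      also have "\<dots> \<le> F z ^ i * (F z)\<^sup>2" using True l by (intro mult_right_mono power_mono) auto
      finally show ?thesis by (simp only: i power_add)
    next
      case False
      then have "(F z)\<^sup>2 \<le> l\<^sup>2" using F[of z] by (intro power_mono) auto
      then have "l ^ i * ((F z)\<^sup>2 + - l\<^sup>2) \<le> 0" using l by (intro mult_nonneg_nonpos) auto
      then show ?thesis using F[of z] by (meson order_trans zero_le_power)
    qed
  qed
  finally show ?thesis .
qed

text \<open>Cauchy-Schwarz and Parseval: there are \<open>L\<close> coefficients, each at most
  1.\<close>

lemma circle_mean_geometric_le: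
  assumes "L \<le> Q" "L \<ge> 1" "0 \<le> \<rho>" "\<rho> \<le> 1"
  shows "circle_mean Q (\<lambda>z. cmod (\<Sum>j<L. (of_real \<rho> * z) ^ j)) \<le> sqrt (real L)"
proof -
  have "(\<Sum>j\<le>L - 1. (\<rho> ^ j)\<^sup>2) \<le> (\<Sum>j\<le>L - 1. 1)"
    using assms by (intro sum_mono power_le_one) auto
  also have "\<dots> = real L" using assms by simp
  finally have le: "(\<Sum>j\<le>L - 1. (\<rho> ^ j)\<^sup>2) \<le> real L" .
  have "{..<L} = {..L - 1}" using assms by auto
  then have "circle_mean Q (\<lambda>z. cmod (\<Sum>j<L. (of_real \<rho> * z) ^ j))
      = circle_mean Q (\<lambda>z. cmod (\<Sum>j\<le>L - 1. of_real (\<rho> ^ j) * z ^ j))"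
    by (simp add: power_mult_distrib)
  also have "\<dots> \<le> sqrt (circle_mean Q (\<lambda>z. (cmod (\<Sum>j\<le>L - 1. of_real (\<rho> ^ j) * z ^ j))\<^sup>2))"
    by (rule circle_mean_le_sqrt)
  also have "\<dots> = sqrt (\<Sum>j\<le>L - 1. (\<rho> ^ j)\<^sup>2)"
    using circle_mean_parseval[of "L - 1" Q "\<lambda>j. \<rho> ^ j"] assms by simp
  finally show ?thesis using le by (meson order_trans real_sqrt_le_mono)
qed

text \<open>The factor \<open>1 - w ^ L\<close> shortens the main term from a geometric sum of
  length \<open>H + 1\<close> to one of length \<open>L\<close>. The comparison value is
  \<open>C\<close> only up to \<open>H\<close>, where truncation leaves the counts
  unchanged.\<close>

lemma shifted_generating_function_le:
  fixes C \<rho> :: real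
  assumes \<rho>: "0 < \<rho>" "\<rho> < 1" and C: "C \<ge> 0" and k: "k \<ge> 1" and L: "L \<ge> 1" and Q: "k * H + L < Q"
    and X: "X \<subseteq> {..H}"
  defines "v \<equiv> \<lambda>j. real (card (tuples k X j)) - (if j \<le> H then C else 0)"
  shows "circle_mean Q (\<lambda>z. cmod (\<Sum>a\<in>X. (of_real \<rho> * z) ^ a) ^ k * cmod (1 - (of_real \<rho> * z) ^ L))
    \<le> 2 * C * sqrt (real L) + 2 * sqrt (\<Sum>j\<le>k * H. (v j)\<^sup>2 * \<rho> ^ (2 * j))"
proof -
  define V where "V z = (\<Sum>j\<le>k * H. of_real (v j * \<rho> ^ j) * z ^ j)" for z :: complex
  have pt: "cmod (\<Sum>a\<in>X. (of_real \<rho> * z) ^ a) ^ k * cmod (1 - (of_real \<rho> * z) ^ L)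
      \<le> 2 * C * cmod (\<Sum>j<L. (of_real \<rho> * z) ^ j) + 2 * cmod (V z)"
    if "z \<in> unity_roots Q" for z
  proof -
    define w where "w = of_real \<rho> * z"
    have "Q > 0" using Q by simp
    then have "norm w = \<rho>" using norm_unity_root that \<rho> by (simp add: w_def norm_mult)
    then have w1: "norm (w ^ n) \<le> 1" for n using \<rho> by (simp add: norm_power power_le_one)
    have w_neq: "w \<noteq> 1" using \<open>norm w = \<rho>\<close> \<rho> by auto
    have w2: "norm (1 - w ^ n) \<le> 2" for n
      using norm_triangle_ineq4[of 1 "w ^ n"] w1[of n] by simp
    have "{..k * H} \<inter> {..H} = {..H}" using k by (cases k) auto
    then have CH: "(\<Sum>j\<le>k * H. (if j \<le> H then of_real C else 0) * w ^ j) = of_real C * (\<Sum>j\<le>H. w ^ j)"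
      by (simp add: if_distrib[where f = "\<lambda>x. x * _"] sum.If_cases sum_distrib_left flip: atMost_def cong: if_cong)
    have "(\<Sum>a\<in>X. w ^ a) ^ k = (\<Sum>j\<le>k * H. of_nat (card (tuples k X j)) * w ^ j)"
      by (rule tuples_generating_function[OF X])
    also have "\<dots> = (\<Sum>j\<le>k * H. (if j \<le> H then of_real C else 0) * w ^ j + of_real (v j * \<rho> ^ j) * z ^ j)"
      by (intro sum.cong refl) (auto simp: v_def w_def power_mult_distrib algebra_simps)
    also have "\<dots> = of_real C * (\<Sum>j\<le>H. w ^ j) + V z"
      by (simp only: sum.distrib CH V_def)
    finally have f: "(\<Sum>a\<in>X. w ^ a) ^ k = of_real C * (\<Sum>j\<le>H. w ^ j) + V z" .
    \<comment> \<open>Both sides equal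
      \<open>(1 - w ^ Suc H) * (1 - w ^ L) / (1 - w)\<close>.\<close>
    have "(\<Sum>j\<le>H. w ^ j) * (1 - w ^ L) = (1 - w ^ Suc H) * (\<Sum>j<L. w ^ j)"
      using w_neq unfolding sum_gp0 sum_gp_strict by simp
    then have "(\<Sum>a\<in>X. w ^ a) ^ k * (1 - w ^ L)
        = of_real C * ((1 - w ^ Suc H) * (\<Sum>j<L. w ^ j)) + V z * (1 - w ^ L)"
      unfolding f by (simp only: distrib_right mult.assoc)
    then have "norm ((\<Sum>a\<in>X. w ^ a) ^ k * (1 - w ^ L))
        \<le> C * (norm (1 - w ^ Suc H) * norm (\<Sum>j<L. w ^ j)) + norm (V z) * norm (1 - w ^ L)"
      using C by (simp only:) (rule order_trans[OF norm_triangle_ineq], simp add: norm_mult)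
    also have "\<dots> \<le> C * (2 * norm (\<Sum>j<L. w ^ j)) + norm (V z) * 2"
      using C by (intro add_mono mult_left_mono mult_right_mono w2) auto
    finally show ?thesis by (simp add: w_def norm_mult norm_power mult_ac)
  qed
  have "circle_mean Q (\<lambda>z. cmod (V z)) \<le> sqrt (circle_mean Q (\<lambda>z. (cmod (V z))\<^sup>2))"
    by (rule circle_mean_le_sqrt)
  also have "circle_mean Q (\<lambda>z. (cmod (V z))\<^sup>2) = (\<Sum>j\<le>k * H. (v j)\<^sup>2 * \<rho> ^ (2 * j))"
    unfolding V_def using Q
    by (subst circle_mean_parseval) (auto simp: power_mult_distrib mult.commute[of 2] power_mult)
  finally have V: "circle_mean Q (\<lambda>z. cmod (V z)) \<le> sqrt (\<Sum>j\<le>k * H. (v j)\<^sup>2 * \<rho> ^ (2 * j))" .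
  have "circle_mean Q (\<lambda>z. cmod (\<Sum>a\<in>X. (of_real \<rho> * z) ^ a) ^ k * cmod (1 - (of_real \<rho> * z) ^ L))
      \<le> circle_mean Q (\<lambda>z. 2 * C * cmod (\<Sum>j<L. (of_real \<rho> * z) ^ j) + 2 * cmod (V z))"
    using pt by (rule circle_mean_mono)
  also have "\<dots> = 2 * C * circle_mean Q (\<lambda>z. cmod (\<Sum>j<L. (of_real \<rho> * z) ^ j)) + 2 * circle_mean Q (\<lambda>z. cmod (V z))"
    by (simp only: circle_mean_add circle_mean_cmult)
  also have "\<dots> \<le> 2 * C * sqrt (real L) + 2 * sqrt (\<Sum>j\<le>k * H. (v j)\<^sup>2 * \<rho> ^ (2 * j))"
    using C V circle_mean_geometric_le[of L Q \<rho>] L Q \<rho> by (intro add_mono mult_left_mono) auto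
  finally show ?thesis .
qed

text \<open>Near orthogonality of the polynomial and a suitable shift bounds a mean from below in
  terms of \<open>S\<close>; the preceding lemma bounds it from above. Squaring the comparison gives
  the claim.\<close>

lemma generating_function_inequality:
  fixes C \<rho> :: real
  assumes \<rho>: "0 < \<rho>" "\<rho> < 1" and C: "C \<ge> 0" and k: "k \<ge> 2" and X: "X \<subseteq> {..H}" "X \<noteq> {}"
  defines "v \<equiv> \<lambda>j. real (card (tuples k X j)) - (if j \<le> H then C else 0)"
    and "S \<equiv> (\<Sum>a\<in>X. \<rho> ^ (2 * a))" and "T \<equiv> (\<Sum>a\<in>X. \<rho> ^ a)"
  shows "4 * (S / 16) ^ k \<le> 8 * C\<^sup>2 * (4 * T\<^sup>2 / S + 1) + 8 * (\<Sum>j\<le>k * H. (v j)\<^sup>2 * \<rho> ^ (2 * j))"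
proof -
  define E where "E = (\<Sum>j\<le>k * H. (v j)\<^sup>2 * \<rho> ^ (2 * j))"
  have fin: "finite X" using X finite_subset by blast
  have S: "S > 0" unfolding S_def using fin X \<rho> by (intro sum_pos) auto
  have T: "T > 0" unfolding T_def using fin X \<rho> by (intro sum_pos) auto
  have E: "E \<ge> 0" unfolding E_def using \<rho> by (intro sum_nonneg) auto
  \<comment> \<open>Some shift up to this \<open>M\<close> has correlation at most
    \<open>T\<^sup>2 / M \<le> S / 4\<close>, so the mean square of the difference is at least
    \<open>S / 2\<close>.\<close>
  define M where "M = nat \<lceil>4 * T\<^sup>2 / S\<rceil>"
  have M0: "4 * T\<^sup>2 / S > 0" using S T by simp
  have M: "real M \<ge> 4 * T\<^sup>2 / S" "real M \<le> 4 * T\<^sup>2 / S + 1" "M \<ge> 1"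
    using M0 unfolding M_def by linarith+
  obtain L where L: "L \<in> {1..M}"
    and corr: "real M * (\<Sum>m\<in>{m\<in>X. m + L \<in> X}. \<rho> ^ (2 * (m + L))) \<le> T\<^sup>2"
    using exists_small_correlation[OF fin, of \<rho> M] \<rho> M(3) unfolding T_def by auto
  define c where "c = (\<Sum>m\<in>{m\<in>X. m + L \<in> X}. \<rho> ^ (2 * (m + L)))"
  have c0: "c \<ge> 0" unfolding c_def using \<rho> by (intro sum_nonneg) auto
  have "4 * T\<^sup>2 / S * c \<le> T\<^sup>2"
    using mult_right_mono[OF M(1) c0] corr by (simp add: c_def)
  then have "T\<^sup>2 * (4 * c) \<le> T\<^sup>2 * S" using S by (simp add: field_simps)
  then have c: "c \<le> S / 4" using T by simp
  define Q where "Q = k * H + L + 1"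
  define P where "P z = (\<Sum>a\<in>X. (of_real \<rho> * z) ^ a)" for z :: complex
  define u where "u z = 1 - (of_real \<rho> * z) ^ L" for z :: complex
  define l where "l = sqrt (S / 4)"
  have l: "l\<^sup>2 = S / 4" "l \<ge> 0" using S by (auto simp: l_def)
  have Q: "k * H + L < Q" "H + L < Q" using k by (cases k; auto simp: Q_def)+
  have "2 * l\<^sup>2 \<le> circle_mean Q (\<lambda>z. (cmod (P z * u z))\<^sup>2)"
    using circle_mean_shift_difference[OF X(1) Q(2), of \<rho>] \<rho> c l
    unfolding P_def u_def c_def S_def by simp
  then have "l ^ k \<le> circle_mean Q (\<lambda>z. cmod (P z * u z) ^ k)"
    using l k by (intro circle_mean_power_ge) (auto simp: Q_def)
  also have "\<dots> \<le> circle_mean Q (\<lambda>z. 2 ^ (k - 1) * (cmod (P z) ^ k * cmod (u z)))"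
  proof (rule circle_mean_mono)
    fix z assume z: "z \<in> unity_roots Q"
    have "norm ((of_real \<rho> * z) ^ L) \<le> 1"
      using norm_unity_root[OF _ z] \<rho> by (simp add: Q_def norm_mult norm_power power_le_one)
    then have "cmod (u z) \<le> 2"
      using norm_triangle_ineq4[of 1 "(of_real \<rho> * z) ^ L"] unfolding u_def norm_one by linarith
    \<comment> \<open>One factor \<open>cmod (u z)\<close> is kept for the upper bound; the other
      \<open>k - 1\<close> are estimated by 2.\<close>
    then have "cmod (u z) ^ (k - 1) * cmod (u z) \<le> 2 ^ (k - 1) * cmod (u z)"
      by (intro mult_right_mono power_mono) auto
    moreover have "cmod (u z) ^ (k - 1) * cmod (u z) = cmod (u z) ^ k"
      using k power_minus_mult[of k "cmod (u z)"] by simp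
    ultimately have "cmod (u z) ^ k \<le> 2 ^ (k - 1) * cmod (u z)" by simp
    then have "cmod (P z) ^ k * cmod (u z) ^ k \<le> cmod (P z) ^ k * (2 ^ (k - 1) * cmod (u z))"
      by (intro mult_left_mono) auto
    then show "cmod (P z * u z) ^ k \<le> 2 ^ (k - 1) * (cmod (P z) ^ k * cmod (u z))"
      by (simp add: norm_mult power_mult_distrib mult_ac)
  qed
  also have "\<dots> = 2 ^ (k - 1) * circle_mean Q (\<lambda>z. cmod (P z) ^ k * cmod (u z))"
    by (rule circle_mean_cmult)
  also have "\<dots> \<le> 2 ^ (k - 1) * (2 * C * sqrt (real L) + 2 * sqrt E)"
    using shifted_generating_function_le[OF \<rho> C _ _ Q(1) X(1)] k L
    unfolding P_def u_def E_def v_def by (intro mult_left_mono) auto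
  also have "\<dots> = 2 ^ k * (C * sqrt (real L) + sqrt E)"
    using k power_minus_mult[of k "2::real"] by (simp add: algebra_simps)
  finally have "l ^ k \<le> 2 ^ k * (C * sqrt (real L) + sqrt E)" .
  \<comment> \<open>Squaring turns \<open>l ^ k\<close> into \<open>(S / 4) ^ k\<close>; dividing by
    \<open>4 ^ k\<close> yields \<open>(S / 16) ^ k\<close>.\<close>
  then have "(l ^ k)\<^sup>2 \<le> (2 ^ k * (C * sqrt (real L) + sqrt E))\<^sup>2"
    using l by (intro power_mono) auto
  then have "(S / 4) ^ k \<le> 4 ^ k * (C * sqrt (real L) + sqrt E)\<^sup>2"
    by (simp add: power_mult_distrib flip: l(1) power_mult) (simp add: mult.commute[of k 2] power_mult)
  also have "\<dots> \<le> 4 ^ k * (2 * (C * sqrt (real L))\<^sup>2 + 2 * (sqrt E)\<^sup>2)"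
    by (intro mult_left_mono sq_add_le) auto
  also have "\<dots> = 4 ^ k * (2 * C\<^sup>2 * real L + 2 * E)"
    using E by (simp add: power_mult_distrib mult_ac)
  also have "\<dots> \<le> 4 ^ k * (2 * C\<^sup>2 * (4 * T\<^sup>2 / S + 1) + 2 * E)"
    using L M by (intro mult_left_mono add_mono) auto
  finally have "(S / 4) ^ k / 4 ^ k \<le> 2 * C\<^sup>2 * (4 * T\<^sup>2 / S + 1) + 2 * E"
    by (simp add: field_simps)
  moreover have "(S / 4) ^ k / 4 ^ k = (S / 16) ^ k" by (simp flip: power_divide)
  ultimately show ?thesis by (simp add: E_def)
qed

section \<open>Non-vanishing of the mean square error\<close>

text \<open>With \<open>h = 1 / (1 - \<rho>)\<close>, the left side of
  \<open>generating_function_inequality\<close> is at least \<open>\<kappa> * h\<close>, while the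
  right side is a constant plus at most \<open>\<kappa> / 2 * h\<close>. A large \<open>h\<close>
  gives a contradiction.\<close>

lemma tuples_error_not_mean_null:
  fixes C :: real
  assumes k: "k \<ge> 2" and C: "C > 0"
  shows "\<not> mean_null (\<lambda>j. (real (card (tuples k A j)) - C)\<^sup>2)"
proof
  define R where "R j = real (card (tuples k A j))" for j
  assume null: "mean_null (\<lambda>j. (real (card (tuples k A j)) - C)\<^sup>2)"
  have bound: "\<exists>K\<ge>0. \<forall>n. (\<Sum>j\<le>n. (R j - C)\<^sup>2) \<le> \<epsilon> * real n + K" if e: "\<epsilon> > 0" for \<epsilon>
  proof -
    obtain K where K: "\<And>n. (\<Sum>j\<le>n. (R j - C)\<^sup>2) \<le> \<epsilon> * real n + K"
      using null e unfolding mean_null_def R_def by blast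
    have "0 \<le> K" using K[of 0] by (simp add: order_trans[OF zero_le_power2])
    then show ?thesis using K by blast
  qed
  define \<kappa> where "\<kappa> = 4 * (1 / 16) ^ k * (C / 32)"
  have \<kappa>: "\<kappa> > 0" using C by (simp add: \<kappa>_def)
  \<comment> \<open>Three instances of the hypothesis: \<open>1\<close> for the growth of
    \<open>R\<close> in mean square, \<open>C\<^sup>2 / 8\<close> for the lower bound on
    \<open>S ^ k\<close>, \<open>\<kappa> / 32\<close> for the error term.\<close>
  obtain K' where K': "K' \<ge> 0" "\<And>n. (\<Sum>j\<le>n. (R j - C)\<^sup>2) \<le> 1 * real n + K'"
    using bound[of 1] by auto
  obtain K0 where K0: "K0 \<ge> 0" "\<And>n. (\<Sum>j\<le>n. (R j - C)\<^sup>2) \<le> C\<^sup>2 / 8 * real n + K0"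
    using bound[of "C\<^sup>2 / 8"] C by auto
  obtain K where K: "K \<ge> 0" "\<And>n. (\<Sum>j\<le>n. (R j - C)\<^sup>2) \<le> \<kappa> / 32 * real n + K"
    using bound[of "\<kappa> / 32"] \<kappa> by auto
  define B where "B = 2 * C\<^sup>2 + 2"
  define K1 where "K1 = 2 * C\<^sup>2 + 2 * K'"
  have B: "B > 0" by (simp add: B_def add_nonneg_pos)
  have K1: "K1 \<ge> 0" using K' by (simp add: K1_def)
  have R2: "(\<Sum>j\<le>n. (R j)\<^sup>2) \<le> B * real n + K1" for n
  proof -
    have "(\<Sum>j\<le>n. (R j)\<^sup>2) \<le> (\<Sum>j\<le>n. 2 * C\<^sup>2 + 2 * (R j - C)\<^sup>2)"
    proof (intro sum_mono)
      fix j show "(R j)\<^sup>2 \<le> 2 * C\<^sup>2 + 2 * (R j - C)\<^sup>2" using sq_add_le[of C "R j - C"] by simp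
    qed
    also have "\<dots> = 2 * C\<^sup>2 * (real n + 1) + 2 * (\<Sum>j\<le>n. (R j - C)\<^sup>2)"
      by (simp add: sum.distrib sum_distrib_left algebra_simps)
    also have "\<dots> \<le> 2 * C\<^sup>2 * (real n + 1) + 2 * (real n + K')" using K'(2)[of n] by simp
    finally show ?thesis by (simp add: B_def K1_def algebra_simps)
  qed
  \<comment> \<open>\<open>Y\<close> will be a lower bound for \<open>S\<close>; its size makes the
    contribution of \<open>T\<^sup>2 / S\<close> at most \<open>\<kappa> / 4 * h\<close> plus a
    constant.\<close>
  define Y where "Y = max 1 (128 * C\<^sup>2 * B / \<kappa>)"
  have Y: "Y \<ge> 1" "32 * C\<^sup>2 * B / Y \<le> \<kappa> / 4"
  proof -
    show "Y \<ge> 1" by (simp add: Y_def)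
    have "128 * C\<^sup>2 * B / \<kappa> \<le> Y" by (simp add: Y_def)
    then show "32 * C\<^sup>2 * B / Y \<le> \<kappa> / 4" using \<kappa> \<open>Y \<ge> 1\<close> by (simp add: field_simps)
  qed
  define c where "c = 8 * C\<^sup>2 * (4 * (1 + K1) + 1) + 8 * K + 8"
  \<comment> \<open>Each summand secures one later inequality; the 2 keeps
    \<open>\<rho> \<ge> 1 / 2\<close>.\<close>
  define h where "h = 2 + 32 / C * (K0 / (2 * C)) + 32 / C * Y ^ k + 2 / \<kappa> * c"
  have c0: "c > 0" using K K1 by (simp add: c_def add_nonneg_pos)
  have parts: "0 \<le> 32 / C * (K0 / (2 * C))" "0 \<le> 32 / C * Y ^ k" "0 \<le> 2 / \<kappa> * c"
    using C K0 Y \<kappa> c0 by auto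
  have h2: "h \<ge> 2" using parts by (simp add: h_def)
  have "32 / C * (K0 / (2 * C)) \<le> h" "32 / C * Y ^ k \<le> h" "2 / \<kappa> * c < h"
    using parts by (simp_all only: h_def)
  then have h: "K0 / (2 * C) \<le> C / 32 * h" "Y ^ k \<le> C / 32 * h" "c < \<kappa> / 2 * h"
    using C \<kappa> by (simp_all add: field_simps)
  define \<rho> where "\<rho> = 1 - 1 / h"
  have \<rho>: "0 < \<rho>" "\<rho> < 1" "1 / (1 - \<rho>) = h" using h2 by (auto simp: \<rho>_def)
  have \<rho>2: "0 \<le> \<rho>\<^sup>2" "\<rho>\<^sup>2 < 1" using \<rho> by (auto simp: power_less_one_iff)
  have "\<rho>\<^sup>2 \<le> \<rho>" using \<rho> by (simp add: power2_eq_square mult_left_le)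
  then have "1 / (1 - \<rho>\<^sup>2) \<le> 1 / (1 - \<rho>)" using \<rho>2 \<rho> by (intro divide_left_mono) auto
  then have h_up: "1 / (1 - \<rho>\<^sup>2) \<le> h" using \<rho> by simp
  have h_low: "1 / (1 - \<rho>\<^sup>2) \<ge> h / 2"
  proof -
    have "1 - \<rho>\<^sup>2 = (1 - \<rho>) * (1 + \<rho>)" by (simp add: power2_eq_square algebra_simps)
    also have "\<dots> \<le> (1 - \<rho>) * 2" using \<rho> by (intro mult_left_mono) auto
    finally have "1 / ((1 - \<rho>) * 2) \<le> 1 / (1 - \<rho>\<^sup>2)" using \<rho>2 \<rho> by (intro divide_left_mono) auto
    moreover have "1 / ((1 - \<rho>) * 2) = h / 2" unfolding \<rho>(3)[symmetric] by simp
    ultimately show ?thesis by simp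
  qed
  define N where "N = K1 + B * h"
  have N: "N \<ge> 2"
  proof -
    have "2 * 1 \<le> B * h" using h2 by (intro mult_mono) (auto simp: B_def)
    then show ?thesis using K1 by (simp add: N_def)
  qed
  have "1 / N > 0" using N by simp
  \<comment> \<open>The truncation point is chosen after \<open>\<rho>\<close>, so that the tail
    beyond \<open>H\<close> costs at most 1.\<close>
  then obtain H where "\<rho> ^ H < 1 / N" using real_arch_pow_inv[of "1 / N" \<rho>] \<rho> by blast
  then have H: "\<rho> ^ H * N \<le> 1" using N by (simp add: field_simps)
  have "\<rho> ^ H * 2 \<le> \<rho> ^ H * N" using N \<rho> by (intro mult_left_mono) auto
  then have Hhalf: "\<rho> ^ H \<le> 1 / 2" using H by simp

  define X where "X = A \<inter> {..H}"
  define RX where "RX j = real (card (tuples k X j))" for j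
  have RX: "RX j \<ge> 0" "RX j \<le> R j" "j \<le> H \<Longrightarrow> RX j = R j" for j
    unfolding RX_def R_def X_def
    by (auto simp: tuples_truncate intro!: card_mono finite_tuples tuples_mono)
  have R_sq: "R j \<le> (R j)\<^sup>2" for j
    unfolding R_def of_nat_power[symmetric] of_nat_le_iff by (simp add: power2_eq_square)
  have XH: "X \<subseteq> {..H}" by (simp add: X_def)
  define S where "S = (\<Sum>a\<in>X. \<rho> ^ (2 * a))"
  define T where "T = (\<Sum>a\<in>X. \<rho> ^ a)"
  have T0: "T \<ge> 0" unfolding T_def using \<rho> by (intro sum_nonneg) auto
  have S0: "S \<ge> 0" unfolding S_def using \<rho> by (intro sum_nonneg) auto

  have sumR2: "(\<Sum>j\<le>n. (R j)\<^sup>2 * \<rho> ^ j) \<le> N" for n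
    using weighted_sum_le[of \<rho> B "\<lambda>j. (R j)\<^sup>2" K1 n] R2 \<rho> B by (simp add: N_def divide_inverse)
  have "T ^ k = (\<Sum>j\<le>k * H. RX j * \<rho> ^ j)"
    unfolding T_def RX_def by (rule tuples_generating_function[OF XH])
  \<comment> \<open>Counts are integers, so each is at most its square.\<close>
  also have "\<dots> \<le> (\<Sum>j\<le>k * H. (R j)\<^sup>2 * \<rho> ^ j)"
    using \<rho> by (intro sum_mono mult_right_mono order_trans[OF RX(2) R_sq]) auto
  also note sumR2
  finally have Tk: "T ^ k \<le> N" .
  have T2: "T\<^sup>2 \<le> 1 + N"
  proof (cases "T \<le> 1")
    case True
    then show ?thesis using T0 N power_le_one[of T 2] by simp
  next
    case False
    then have "T\<^sup>2 \<le> T ^ k" using k by (intro power_increasing) auto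
    then show ?thesis using Tk by simp
  qed

  have "S ^ k = (\<Sum>a\<in>X. (\<rho>\<^sup>2) ^ a) ^ k" by (simp add: S_def power_mult)
  also have "\<dots> = (\<Sum>j\<le>k * H. RX j * (\<rho>\<^sup>2) ^ j)"
    unfolding RX_def by (rule tuples_generating_function[OF XH])
  also have "\<dots> \<ge> (\<Sum>j\<le>H. RX j * (\<rho>\<^sup>2) ^ j)"
    using k RX(1) by (intro sum_mono2) auto
  also have "(\<Sum>j\<le>H. RX j * (\<rho>\<^sup>2) ^ j) \<ge> (\<Sum>j\<le>H. (C / 2 - (R j - C)\<^sup>2 / (2 * C)) * (\<rho>\<^sup>2) ^ j)"
  proof (intro sum_mono mult_right_mono)
    fix j assume "j \<in> {..H}"
    \<comment> \<open>A lower bound for \<open>R j\<close> in terms of its squared error, which is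
      what the hypothesis controls.\<close>
    have "0 \<le> (R j)\<^sup>2 / (2 * C)" using C by simp
    also have "\<dots> = R j - (C / 2 - (R j - C)\<^sup>2 / (2 * C))"
      using C by (simp add: field_simps power2_eq_square)
    finally show "C / 2 - (R j - C)\<^sup>2 / (2 * C) \<le> RX j" using RX(3) \<open>j \<in> {..H}\<close> by simp
  qed auto
  also have "(\<Sum>j\<le>H. (C / 2 - (R j - C)\<^sup>2 / (2 * C)) * (\<rho>\<^sup>2) ^ j)
      = C / 2 * (\<Sum>j\<le>H. (\<rho>\<^sup>2) ^ j) - (\<Sum>j\<le>H. (R j - C)\<^sup>2 * (\<rho>\<^sup>2) ^ j) / (2 * C)"
    by (simp add: left_diff_distrib sum_subtractf sum_distrib_left sum_divide_distrib)
  finally have S1: "S ^ k \<ge> C / 2 * (\<Sum>j\<le>H. (\<rho>\<^sup>2) ^ j) - (\<Sum>j\<le>H. (R j - C)\<^sup>2 * (\<rho>\<^sup>2) ^ j) / (2 * C)" .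
  have geo: "(\<Sum>j\<le>H. (\<rho>\<^sup>2) ^ j) \<ge> h / 4"
  proof -
    have "(\<rho>\<^sup>2) ^ Suc H \<le> \<rho> ^ H"
      using \<rho> by (simp only: power_mult[symmetric]) (intro power_decreasing, auto)
    then have "1 / 2 \<le> 1 - (\<rho>\<^sup>2) ^ Suc H" using Hhalf by simp
    then have "1 / 2 * (h / 2) \<le> (1 - (\<rho>\<^sup>2) ^ Suc H) * (1 / (1 - \<rho>\<^sup>2))"
      using h_low h2 by (intro mult_mono) auto
    also have "\<dots> = (\<Sum>j\<le>H. (\<rho>\<^sup>2) ^ j)"
      using \<rho>2 sum_gp0[of "\<rho>\<^sup>2" H] by auto
    finally show ?thesis by simp
  qed
  have err0: "(\<Sum>j\<le>H. (R j - C)\<^sup>2 * (\<rho>\<^sup>2) ^ j) \<le> K0 + C\<^sup>2 / 8 * h"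
  proof -
    have "(\<Sum>j\<le>H. (R j - C)\<^sup>2 * (\<rho>\<^sup>2) ^ j) \<le> K0 + C\<^sup>2 / 8 / (1 - \<rho>\<^sup>2)"
      using weighted_sum_le[OF \<rho>2 _ K0(2)] by simp
    also have "\<dots> \<le> K0 + C\<^sup>2 / 8 * h"
      using mult_left_mono[OF h_up, of "C\<^sup>2 / 8"] by simp
    finally show ?thesis .
  qed
  have "S ^ k \<ge> C / 2 * (h / 4) - (K0 + C\<^sup>2 / 8 * h) / (2 * C)"
  proof -
    have "C / 2 * (h / 4) \<le> C / 2 * (\<Sum>j\<le>H. (\<rho>\<^sup>2) ^ j)" using geo C by (intro mult_left_mono) auto
    moreover have "(\<Sum>j\<le>H. (R j - C)\<^sup>2 * (\<rho>\<^sup>2) ^ j) / (2 * C) \<le> (K0 + C\<^sup>2 / 8 * h) / (2 * C)"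
      using err0 C by (intro divide_right_mono) auto
    ultimately show ?thesis using S1 by linarith
  qed
  \<comment> \<open>The coefficient of \<open>h\<close> is \<open>C / 8 - C / 16 = C / 16\<close>;
    one half of it absorbs \<open>K0 / (2 * C)\<close>.\<close>
  also have "C / 2 * (h / 4) - (K0 + C\<^sup>2 / 8 * h) / (2 * C) = C / 32 * h + (C / 32 * h - K0 / (2 * C))"
    using C by (simp add: field_simps power2_eq_square)
  finally have Sk: "S ^ k \<ge> C / 32 * h" using h(1) by linarith
  then have "Y ^ k \<le> S ^ k" using h(2) by linarith
  then have SY: "Y \<le> S" using S0 k by (intro power_le_imp_le_base[of Y "k - 1"]) auto
  then have S1: "S \<ge> 1" using Y by simp
  then have Xne: "X \<noteq> {}" by (auto simp: S_def)

  define v where "v j = RX j - (if j \<le> H then C else 0)" for j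
  \<comment> \<open>Up to \<open>H\<close> the truncated counts are exact; beyond \<open>H\<close>
    one factor \<open>\<rho> ^ j\<close> is at most \<open>\<rho> ^ H\<close>.\<close>
  have "(\<Sum>j\<le>k * H. (v j)\<^sup>2 * \<rho> ^ (2 * j))
      \<le> (\<Sum>j\<le>k * H. (if j \<le> H then (R j - C)\<^sup>2 * (\<rho>\<^sup>2) ^ j else 0) + \<rho> ^ H * ((R j)\<^sup>2 * \<rho> ^ j))"
  proof (intro sum_mono)
    fix j
    show "(v j)\<^sup>2 * \<rho> ^ (2 * j)
        \<le> (if j \<le> H then (R j - C)\<^sup>2 * (\<rho>\<^sup>2) ^ j else 0) + \<rho> ^ H * ((R j)\<^sup>2 * \<rho> ^ j)"
    proof (cases "j \<le> H")
      case True
      then show ?thesis using RX(3)[of j] \<rho> by (simp add: v_def power_mult)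
    next
      case False
      have "(v j)\<^sup>2 * \<rho> ^ (2 * j) = (RX j)\<^sup>2 * (\<rho> ^ j * \<rho> ^ j)"
        using False by (simp add: v_def mult_2 power_add)
      also have "\<dots> \<le> (R j)\<^sup>2 * (\<rho> ^ H * \<rho> ^ j)"
        using RX[of j] False \<rho> by (intro mult_mono power_mono mult_right_mono power_decreasing) auto
      finally show ?thesis using False by (simp add: mult_ac)
    qed
  qed
  also have "\<dots> = (\<Sum>j\<le>H. (R j - C)\<^sup>2 * (\<rho>\<^sup>2) ^ j) + \<rho> ^ H * (\<Sum>j\<le>k * H. (R j)\<^sup>2 * \<rho> ^ j)"
  proof -
    have "{..k * H} \<inter> {..H} = {..H}" using k by (cases k) auto
    then show ?thesis
      by (simp add: sum.distrib sum.If_cases sum_distrib_left flip: atMost_def)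
  qed
  also have "\<dots> \<le> (K + \<kappa> / 32 * h) + 1"
  proof (rule add_mono)
    have "(\<Sum>j\<le>H. (R j - C)\<^sup>2 * (\<rho>\<^sup>2) ^ j) \<le> K + \<kappa> / 32 / (1 - \<rho>\<^sup>2)"
      using weighted_sum_le[OF \<rho>2 _ K(2)] \<kappa> by simp
    also have "\<dots> \<le> K + \<kappa> / 32 * h"
      using mult_left_mono[OF h_up, of "\<kappa> / 32"] \<kappa> by simp
    finally show "(\<Sum>j\<le>H. (R j - C)\<^sup>2 * (\<rho>\<^sup>2) ^ j) \<le> K + \<kappa> / 32 * h" .
    have "\<rho> ^ H * (\<Sum>j\<le>k * H. (R j)\<^sup>2 * \<rho> ^ j) \<le> \<rho> ^ H * N"
      using sumR2 \<rho> by (intro mult_left_mono) auto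
    then show "\<rho> ^ H * (\<Sum>j\<le>k * H. (R j)\<^sup>2 * \<rho> ^ j) \<le> 1" using H by linarith
  qed
  finally have E: "(\<Sum>j\<le>k * H. (v j)\<^sup>2 * \<rho> ^ (2 * j)) \<le> K + \<kappa> / 32 * h + 1" by simp

  have TS: "4 * T\<^sup>2 / S \<le> 4 * (1 + K1) + 4 * B * h / Y"
  proof -
    have "4 * T\<^sup>2 / S \<le> 4 * (1 + N) / Y"
      using T2 SY Y N by (intro frac_le) auto
    also have "\<dots> = 4 * (1 + K1) / Y + 4 * B * h / Y" by (simp add: N_def add_divide_distrib algebra_simps)
    also have "4 * (1 + K1) / Y \<le> 4 * (1 + K1) / 1" using Y K1 by (intro divide_left_mono) auto
    finally show ?thesis by simp
  qed
  have "\<kappa> * h = 4 * (1 / 16) ^ k * (C / 32 * h)" by (simp add: \<kappa>_def)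
  also have "\<dots> \<le> 4 * (1 / 16) ^ k * S ^ k" using Sk by (intro mult_left_mono) auto
  also have "\<dots> = 4 * (S / 16) ^ k" by (simp add: power_divide)
  also have "\<dots> \<le> 8 * C\<^sup>2 * (4 * T\<^sup>2 / S + 1) + 8 * (\<Sum>j\<le>k * H. (v j)\<^sup>2 * \<rho> ^ (2 * j))"
    using generating_function_inequality[OF \<rho>(1,2) _ k XH Xne, of C] C
    unfolding S_def T_def v_def RX_def by simp
  also have "\<dots> \<le> 8 * C\<^sup>2 * (4 * (1 + K1) + 4 * B * h / Y + 1) + 8 * (K + \<kappa> / 32 * h + 1)"
    using TS E by (intro add_mono mult_left_mono) auto
  \<comment> \<open>Two terms of size \<open>\<kappa> / 4 * h\<close> and
    \<open>c < \<kappa> / 2 * h\<close> stay below \<open>\<kappa> * h\<close>.\<close>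
  also have "\<dots> = c + 32 * C\<^sup>2 * B / Y * h + \<kappa> / 4 * h"
    by (simp add: c_def algebra_simps)
  also have "\<dots> \<le> c + \<kappa> / 4 * h + \<kappa> / 4 * h"
    using mult_right_mono[OF Y(2), of h] h2 by simp
  also have "\<dots> < \<kappa> * h" using h(3) by simp
  finally show False by simp
qed

section \<open>From the upper limit to bounds on partial sums\<close>

lemma mean_null_if_limsup_nonpos:
  fixes g :: "nat \<Rightarrow> real"
  assumes "\<not> limsup (\<lambda>n. ereal (1 / real n * (\<Sum>j=0..n. g j))) > 0"
  shows "mean_null g"
  unfolding mean_null_def
proof (intro allI impI)
  fix \<epsilon> :: real assume e: "\<epsilon> > 0"
  have "limsup (\<lambda>n. ereal (1 / real n * (\<Sum>j=0..n. g j))) < ereal \<epsilon>"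
    using assms e by (meson ereal_less(2) le_less_trans not_less)
  then have "\<forall>\<^sub>F n in sequentially. ereal (1 / real n * (\<Sum>j=0..n. g j)) < ereal \<epsilon>"
    by (rule Limsup_lessD)
  then obtain N where N: "\<And>n. n \<ge> N \<Longrightarrow> 1 / real n * (\<Sum>j=0..n. g j) < \<epsilon>"
    by (auto simp: eventually_sequentially)
  \<comment> \<open>\<open>K\<close> covers the finitely many \<open>n \<le> N\<close>, including
    \<open>n = 0\<close>, where the quotient is 0 by convention.\<close>
  define K where "K = (\<Sum>m\<le>N. \<bar>\<Sum>j\<le>m. g j\<bar>)"
  have K0: "K \<ge> 0" by (simp add: K_def sum_nonneg)
  have "(\<Sum>j\<le>n. g j) \<le> \<epsilon> * real n + K" for n
  proof (cases "n \<le> N")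
    case True
    have "\<bar>\<Sum>j\<le>n. g j\<bar> \<le> K"
      unfolding K_def using True member_le_sum[of n "{..N}" "\<lambda>m. \<bar>\<Sum>j\<le>m. g j\<bar>"] by simp
    moreover have "\<epsilon> * real n \<ge> 0" using e by simp
    ultimately show ?thesis by linarith
  next
    case False
    then have "(\<Sum>j\<le>n. g j) < \<epsilon> * real n"
      using N[of n] by (simp add: field_simps atLeast0AtMost)
    then show ?thesis using K0 by linarith
  qed
  then show "\<exists>K. \<forall>n. (\<Sum>j\<le>n. g j) \<le> \<epsilon> * real n + K" by blast
qed

section \<open>Counting subsets for \<open>c = 0\<close>\<close>

lemma binomial_le_sum_rep_count:
  fixes a :: "nat \<Rightarrow> nat"
  assumes star: "star \<in> {(\<le>), (<)}" and a: "strict_mono_on {1..} a" and A: "A = a ` {1..}"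
    and n: "k * a s \<le> n" and s: "s \<ge> 1"
  shows "s choose k \<le> (\<Sum>j\<le>n. rep_count star k A j)"
proof -
  \<comment> \<open>Sorting a set in \<open>?F\<close> gives a strictly increasing tuple, admissible
    for both orders, with sum at most \<open>k * a s\<close>; different sets give different
    tuples.\<close>
  let ?F = "{Z. Z \<subseteq> a ` {1..s} \<and> card Z = k}"
  have inj: "inj_on a {1..s}"
    using strict_mono_on_imp_inj_on[OF a] by (rule inj_on_subset) auto
  have le: "x \<le> a s" if "x \<in> a ` {1..s}" for x
    using that strict_mono_on_leD[OF a] by auto
  have rep: "rep_count star k A j = card {xs. length xs = k \<and> set xs \<subseteq> A \<and> sorted_wrt star xs \<and> sum_list xs = j}" for j
    by (simp add: rep_count_def)
  have "s choose k = card ?F"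
    using n_subsets[of "a ` {1..s}" k] card_image[OF inj] by simp
  also have "\<dots> = card (sorted_list_of_set ` ?F)"
  proof (rule card_image[symmetric], rule inj_onI)
    fix Y Z assume "Y \<in> ?F" "Z \<in> ?F" "sorted_list_of_set Y = sorted_list_of_set Z"
    moreover from this have "finite Y" "finite Z" by (auto intro: finite_subset)
    ultimately show "Y = Z" by (metis set_sorted_list_of_set)
  qed
  also have "\<dots> \<le> card (\<Union>j\<le>n. {xs. length xs = k \<and> set xs \<subseteq> A \<and> sorted_wrt star xs \<and> sum_list xs = j})"
  proof (rule card_mono)
    show "finite (\<Union>j\<le>n. {xs. length xs = k \<and> set xs \<subseteq> A \<and> sorted_wrt star xs \<and> sum_list xs = j})"
      by (auto intro!: finite_subset[OF _ finite_tuples[of k A]] simp: tuples_def)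
    show "sorted_list_of_set ` ?F \<subseteq> (\<Union>j\<le>n. {xs. length xs = k \<and> set xs \<subseteq> A \<and> sorted_wrt star xs \<and> sum_list xs = j})"
    proof (intro image_subsetI)
      fix Z assume Z: "Z \<in> ?F"
      then have fin: "finite Z" by (auto intro: finite_subset)
      let ?xs = "sorted_list_of_set Z"
      have "set ?xs \<subseteq> {..a s}" using Z fin le by auto
      then have "sum_list ?xs \<le> n"
        using sum_list_le_length_mult[of ?xs "a s"] Z fin n by auto
      moreover have "sorted_wrt star ?xs" using star fin by auto
      moreover have "set ?xs \<subseteq> A" using Z fin A by auto
      ultimately show "?xs \<in> (\<Union>j\<le>n. {xs. length xs = k \<and> set xs \<subseteq> A \<and> sorted_wrt star xs \<and> sum_list xs = j})"
        using Z fin by auto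
    qed
  qed
  also have "\<dots> \<le> (\<Sum>j\<le>n. rep_count star k A j)"
    unfolding rep by (rule card_UN_le) simp
  finally show ?thesis .
qed

text \<open>At least \<open>(s / k) ^ k\<close> tuples have sum at most \<open>n\<close>, where
  \<open>n\<close> is a constant times \<open>s ^ k\<close>. Hence the counts, and so their squares,
  have mean bounded below.\<close>

lemma rep_count_not_mean_null:
  fixes a :: "nat \<Rightarrow> nat"
  assumes k: "k \<ge> 1" and star: "star \<in> {(\<le>), (<)}"
    and a: "strict_mono_on {1..} a" and A: "A = a ` {1..}"
    and bd: "bounded ((\<lambda>s. real (a s) / real s ^ k) ` {1..})"
  shows "\<not> mean_null (\<lambda>j. (real (rep_count star k A j))\<^sup>2)"
proof
  assume null: "mean_null (\<lambda>j. (real (rep_count star k A j))\<^sup>2)"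
  obtain b0 where b0: "\<And>s. s \<ge> 1 \<Longrightarrow> real (a s) / real s ^ k \<le> b0"
    using bd unfolding bounded_iff by fastforce
  define b where "b = nat \<lceil>b0\<rceil> + 1"
  have b1: "b \<ge> 1" by (simp add: b_def)
  have as: "a s \<le> b * s ^ k" if "s \<ge> 1" for s
  proof -
    have "real (a s) / real s ^ k \<le> real b" using b0[OF that] unfolding b_def by linarith
    then have "real (a s) \<le> real (b * s ^ k)" using that by (simp add: divide_le_eq)
    then show ?thesis by (simp only: of_nat_le_iff)
  qed
  \<comment> \<open>With \<open>n = k * (b * s ^ k)\<close> this makes \<open>\<delta> * n\<close>
    half of \<open>(s / k) ^ k\<close>.\<close>
  define \<delta> where "\<delta> = 1 / (2 * real k ^ k * real (k * b))"
  have d: "\<delta> > 0" using k b1 by (simp add: \<delta>_def)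
  obtain K where K: "\<And>n. (\<Sum>j\<le>n. (real (rep_count star k A j))\<^sup>2) \<le> \<delta> * real n + K"
    using null d unfolding mean_null_def by blast
  have main: "real s ^ k \<le> 2 * real k ^ k * K" if s: "s \<ge> k" for s
  proof -
    define n where "n = k * (b * s ^ k)"
    have s1: "s \<ge> 1" using s k by simp
    have "(real s / real k) ^ k \<le> real (s choose k)"
      using binomial_ge_n_over_k_pow_k[OF s] by simp
    also have "\<dots> \<le> real (\<Sum>j\<le>n. rep_count star k A j)"
      unfolding of_nat_le_iff using as[OF s1] s1 by (intro binomial_le_sum_rep_count[OF star a A]) (auto simp: n_def)
    also have "\<dots> \<le> (\<Sum>j\<le>n. (real (rep_count star k A j))\<^sup>2)"
      unfolding of_nat_sum
    proof (intro sum_mono)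
      fix j
      have "rep_count star k A j \<le> (rep_count star k A j)\<^sup>2" by (simp add: power2_eq_square)
      then show "real (rep_count star k A j) \<le> (real (rep_count star k A j))\<^sup>2"
        by (metis of_nat_le_iff of_nat_power)
    qed
    also have "\<dots> \<le> \<delta> * real n + K" by (rule K)
    also have "\<delta> * real n = real s ^ k / (2 * real k ^ k)"
      using k b1 by (simp add: \<delta>_def n_def)
    finally show ?thesis using k by (simp add: power_divide field_simps)
  qed
  obtain s where s: "real s > max (real k) (2 * real k ^ k * K)" using reals_Archimedean2 by blast
  have "real s ^ 1 \<le> real s ^ k" using s k by (intro power_increasing) auto
  moreover have "real s ^ k \<le> 2 * real k ^ k * K" using s by (intro main) simp
  ultimately show False using s unfolding power_one_right by linarith
qed

theorem theorem2:
  fixes k :: nat and c :: real and star :: "nat \<Rightarrow> nat \<Rightarrow> bool"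
    and a :: "nat \<Rightarrow> nat" and A :: "nat set"
  assumes "k \<ge> 2" and "c \<ge> 0" and "star \<in> {(\<le>), (<)}"
    and "strict_mono_on {1..} a" and "A = a ` {1..}"
    and "c > 0 \<or> bounded ((\<lambda>s. real (a s) / real s ^ k) ` {1..})"
  shows "limsup (\<lambda>n. ereal (mean_sq_error star k c A n)) > 0"
proof (rule ccontr)
  assume "\<not> limsup (\<lambda>n. ereal (mean_sq_error star k c A n)) > 0"
  then have null: "mean_null (\<lambda>j. (real (rep_count star k A j) - c)\<^sup>2)"
    unfolding mean_sq_error_def by (rule mean_null_if_limsup_nonpos)
  show False
  \<comment> \<open>For \<open>c > 0\<close> the ordered counts approximate
    \<open>fact k * c\<close>; for \<open>c = 0\<close> the error is the squared count
    itself.\<close>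
  proof (cases "c > 0")
    case True
    then show False
      using tuples_error_not_mean_null[OF assms(1), of "fact k * c"]
        tuples_error_mean_null[OF assms(3,1) null] by simp
  next
    case False
    with assms have "c = 0" "bounded ((\<lambda>s. real (a s) / real s ^ k) ` {1..})" by auto
    then show False
      using rep_count_not_mean_null[OF _ assms(3-5)] assms(1) null by simp
  qed
qed

end
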